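(* Let $1\le p\le 2$. Let $\Lambda=\bigcup_{t\in T}\{t\}\times S_t$, where $T\subset\mathbb R$ is a uniformly discrete (finite or countable) set and each $S_t\subset\mathbb R$ is a nonempty finite or countable set. Suppose that $g\in L^p(\mathbb R)$ and that $\mathcal G(g;\Lambda)$ is an unconditional basic sequence in $L^p(\mathbb R)$. Then $\mathcal G(g;\Lambda)$ is equivalent to the standard unit vector basis of $\big(\bigoplus_{t\in T}\ell^2_{S_t}\big)_p$; that is, $$\Big\|\sum_{(t,s)\in\Lambda}a_{ts}\,e_s\tau_t g\Big\|_p\asymp\Big(\sum_{t\in T}\Big(\sum_{s\in S_t}|a_{ts}|^2\Big)^{p/2}\Big)^{1/p}$$ for all finitely supported scalars $\{a_{ts}\}$, with implied constants independent of $\{a_{ts}\}$.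
   Context: For $t,s\in\mathbb R$ write $(\tau_t g)(x)=g(x-t)$, $e_s(x)=e^{2\pi i s x}$, $\mathcal G(g;\Lambda)=\{e_s\tau_t g:(t,s)\in\Lambda\}$. A set $T\subset\mathbb R$ is uniformly discrete if $\inf\{|t-t'|:t\ne t'\in T\}>0$. A system in a Banach space is an unconditional basic sequence if it is an unconditional basis (unique, unconditionally convergent expansions) of its closed linear span. $\ell^2_{S}$ denotes $\ell^2$ of sequences indexed by $S$; for Banach spaces $X_n$, $(\bigoplus_n X_n)_p=\{(x_n):x_n\in X_n,\ \|(x_n)\|=(\sum_n\|x_n\|^p)^{1/p}<\infty\}$. Its standard unit vector basis is indexed by $\Lambda$ (the vector $\delta_{ts}$ in the $t$-th summand). Two systems indexed by the same set are equivalent if the norms of corresponding finite linear combinations are comparable with constants independent of the coefficients. *)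

theory Defs
  imports "HOL-Analysis.Analysis"
begin

definition Lp_integral :: "real \<Rightarrow> (real \<Rightarrow> complex) \<Rightarrow> ennreal" where
  "Lp_integral p f = (\<integral>\<^sup>+ x. ennreal (cmod (f x) powr p) \<partial>lborel)"

definition memLp :: "real \<Rightarrow> (real \<Rightarrow> complex) \<Rightarrow> bool" where
  "memLp p f \<longleftrightarrow> f \<in> borel_measurable lborel \<and> Lp_integral p f < \<infinity>"

definition Lp_norm :: "real \<Rightarrow> (real \<Rightarrow> complex) \<Rightarrow> real" where
  "Lp_norm p f = enn2real (Lp_integral p f) powr (1 / p)"

definition transl :: "real \<Rightarrow> (real \<Rightarrow> complex) \<Rightarrow> real \<Rightarrow> complex" where
  "transl t g = (\<lambda>x. g (x - t))"

definition expo :: "real \<Rightarrow> real \<Rightarrow> complex" where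
  "expo s = (\<lambda>x. exp (\<i> * complex_of_real (2 * pi * s * x)))"

definition gabor :: "(real \<Rightarrow> complex) \<Rightarrow> real \<times> real \<Rightarrow> real \<Rightarrow> complex" where
  "gabor g = (\<lambda>(t, s) x. expo s x * transl t g x)"

definition uniformly_discrete :: "real set \<Rightarrow> bool" where
  "uniformly_discrete T \<longleftrightarrow> (\<exists>\<delta>>0. \<forall>t\<in>T. \<forall>t'\<in>T. t \<noteq> t' \<longrightarrow> \<delta> \<le> \<bar>t - t'\<bar>)"

definition lin_comb :: "('i \<Rightarrow> real \<Rightarrow> complex) \<Rightarrow> 'i set \<Rightarrow> ('i \<Rightarrow> complex) \<Rightarrow> real \<Rightarrow> complex" where
  "lin_comb x F c = (\<lambda>y. \<Sum>i\<in>F. c i * x i y)"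

definition closed_span_Lp :: "real \<Rightarrow> ('i \<Rightarrow> real \<Rightarrow> complex) \<Rightarrow> 'i set \<Rightarrow> (real \<Rightarrow> complex) set" where
  "closed_span_Lp p x I = {f. memLp p f \<and>
     (\<forall>\<epsilon>>0. \<exists>F c. finite F \<and> F \<subseteq> I \<and> Lp_norm p (\<lambda>y. f y - lin_comb x F c y) < \<epsilon>)}"

definition uncond_converges_Lp :: "real \<Rightarrow> ('i \<Rightarrow> real \<Rightarrow> complex) \<Rightarrow> 'i set \<Rightarrow> ('i \<Rightarrow> complex) \<Rightarrow> (real \<Rightarrow> complex) \<Rightarrow> bool" where
  "uncond_converges_Lp p x I c f \<longleftrightarrow>
     (\<forall>\<epsilon>>0. \<exists>F0. finite F0 \<and> F0 \<subseteq> I \<and>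
        (\<forall>F. finite F \<and> F0 \<subseteq> F \<and> F \<subseteq> I \<longrightarrow> Lp_norm p (\<lambda>y. f y - lin_comb x F c y) < \<epsilon>))"

definition uncond_basic_seq_Lp :: "real \<Rightarrow> ('i \<Rightarrow> real \<Rightarrow> complex) \<Rightarrow> 'i set \<Rightarrow> bool" where
  "uncond_basic_seq_Lp p x I \<longleftrightarrow> (\<forall>i\<in>I. memLp p (x i)) \<and>
     (\<forall>f\<in>closed_span_Lp p x I. \<exists>!c. (\<forall>i. i \<notin> I \<longrightarrow> c i = 0) \<and> uncond_converges_Lp p x I c f)"

end

theory Submission
  imports Defs "HOL-Library.Function_Algebras"
begin

text \<open>
  An open mapping argument shows that an unconditional basic sequence has a uniform
  unconditionality constant, so the \<open>p\<close>-th power of the norm of a finite combination is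
  comparable with its average over all choices of signs. By Khinchine's inequality that average is
  comparable with the integral of the \<open>p\<close>-th power of the square function. A modulation has modulus
  one, so for a Gabor system the squared square function is \<open>\<Sum>t. A\<^sub>t * \<bar>g (y - t)\<bar>\<^sup>2\<close> with
  \<open>A\<^sub>t = \<Sum>s. \<bar>a (t, s)\<bar>\<^sup>2\<close>. The upper bound follows from the subadditivity of
  \<open>u \<mapsto> u powr (p / 2)\<close>. For the lower bound, fix an interval no longer than the separation of \<open>T\<close> on
  which \<open>g\<close> does not vanish almost everywhere: its translates by \<open>T\<close> are disjoint, and on each of
  them the square function dominates a single summand.
\<close>

section \<open>Open mapping argument in complete seminormed spaces\<close>

text \<open>The hypothesis gives every vector of the closed span exactly one unconditionally
  convergent expansion, but no estimate: neither linearity nor continuity of the coefficients is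
  assumed. The obstacle is to extract one constant for all choices of signs. For this the span is
  renormed by \<open>sup_proj\<close>, the supremum of the finite partial sums of an expansion, and
  Zabreiko's lemma bounds it by the original norm. That lemma asks only for homogeneity and
  countable subadditivity, so the argument stays on the span and avoids building a Banach space of
  coefficient sequences. Countable subadditivity is where uniqueness enters: coefficients summed
  term by term expand the limit, hence they are its coefficients.

  Functions that agree almost everywhere are not identified, so everything is stated for a seminorm
  \<open>N\<close> on a carrier \<open>V\<close>. Completeness is expressed through absolutely
  summable series, because nested balls, successive approximation and the Riesz-Fischer theorem all
  work with such series.\<close>

locale complete_seminormed = vector_space sc
  for sc :: "complex \<Rightarrow> 'v::ab_group_add \<Rightarrow> 'v" (infixr \<open>*c\<close> 75) +
  fixes V :: "'v set" and N :: "'v \<Rightarrow> real"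
  assumes subspace_V: "subspace V"
    and N_nonneg: "v \<in> V \<Longrightarrow> 0 \<le> N v"
    and N_triangle: "u \<in> V \<Longrightarrow> v \<in> V \<Longrightarrow> N (u + v) \<le> N u + N v"
    and N_scale: "v \<in> V \<Longrightarrow> N (c *c v) = cmod c * N v"
    and N_complete: "(\<And>n. h n \<in> V) \<Longrightarrow> summable (\<lambda>n. N (h n)) \<Longrightarrow>
      \<exists>v\<in>V. (\<lambda>n::nat. N (v - (\<Sum>k<n. h k))) \<longlonglongrightarrow> 0"
begin

lemmas V_intros = subspace_0[OF subspace_V] subspace_add[OF subspace_V]
  subspace_diff[OF subspace_V] subspace_scale[OF subspace_V] subspace_sum[OF subspace_V]

lemma N_zero: "N 0 = 0"
  using N_scale[of 0 0] V_intros(1) by simp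

lemma N_minus_commute: assumes "u \<in> V" "v \<in> V" shows "N (u - v) = N (v - u)"
proof -
  have "(-1) *c (v - u) = u - v" by (simp add: scale_minus_left)
  with N_scale[of "v - u" "-1"] assms show ?thesis by (simp add: V_intros)
qed

lemma N_triangle_sub:
  assumes "u \<in> V" "v \<in> V" "w \<in> V" shows "N (u - w) \<le> N (u - v) + N (v - w)"
  using N_triangle[of "u - v" "v - w"] assms by (simp add: V_intros)

lemma N_diff_le: assumes "u \<in> V" "v \<in> V" shows "N (u - v) \<le> N u + N v"
  using N_triangle_sub[of u 0 v] N_minus_commute[of 0 v] assms by (simp add: V_intros)

lemma N_sum: "(\<And>i. i \<in> F \<Longrightarrow> u i \<in> V) \<Longrightarrow> N (\<Sum>i\<in>F. u i) \<le> (\<Sum>i\<in>F. N (u i))"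
proof (induction F rule: infinite_finite_induct)
  case (insert i F)
  then have "N (u i + sum u F) \<le> N (u i) + N (sum u F)"
    by (intro N_triangle V_intros) auto
  with insert show ?case by force
qed (auto simp: N_zero)

text \<open>Zabreiko's lemma. The first half is a Baire category argument by nested balls: some
  sublevel set of \<open>q\<close> is dense in a ball. The second half is the successive approximation
  from the open mapping theorem.\<close>

lemma zabreiko_dense_ball:
  fixes q :: "'v \<Rightarrow> real"
  shows "\<exists>m. \<exists>w\<in>V. \<exists>r>0. \<forall>v\<in>V. N (v - w) < r \<longrightarrow> (\<forall>\<epsilon>>0. \<exists>a\<in>V. q a \<le> m \<and> N (v - a) < \<epsilon>)"
proof (rule ccontr)
  assume not_dense: "\<not> ?thesis"
  have H: "\<exists>v\<in>V. N (v - w) < r \<and> (\<exists>\<epsilon>>0. \<forall>a\<in>V. q a \<le> m \<longrightarrow> \<epsilon> \<le> N (v - a))"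
    if "w \<in> V" "r > 0" for w r m
  proof (rule ccontr)
    assume neg: "\<not> ?thesis"
    have "\<exists>a\<in>V. q a \<le> m \<and> N (v - a) < \<epsilon>" if "v \<in> V" "N (v - w) < r" "\<epsilon> > 0" for v \<epsilon>
      using neg that not_le by blast
    with not_dense \<open>w \<in> V\<close> \<open>r > 0\<close> show False by blast
  qed
  \<comment> \<open>A pair is a centre and a radius. Each step of the centres is at most the drop of
    the radius, so the limit stays within the \<open>n\<close>-th radius of the \<open>n\<close>-th
    centre. The factor 2 keeps the sublevel set twice as far away, so the limit lies in no sublevel
    set of \<open>q\<close>, which is absurd.\<close>
  have "\<exists>f. \<forall>n::nat. (fst (f n) \<in> V \<and> snd (f n) > 0) \<and>
      (N (fst (f (Suc n)) - fst (f n)) < snd (f n) / 2 \<and> snd (f (Suc n)) \<le> snd (f n) / 2 \<and>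
        (\<forall>a\<in>V. q a \<le> real n \<longrightarrow> 2 * snd (f (Suc n)) \<le> N (fst (f (Suc n)) - a)))"
  proof (rule dependent_nat_choice)
    show "\<exists>x. fst x \<in> V \<and> (0::real) < snd x"
      using V_intros(1) by (intro exI[of _ "(0, 1)"]) auto
  next
    fix x :: "'v \<times> real" and n :: nat
    assume x: "fst x \<in> V \<and> 0 < snd x"
    with H[of "fst x" "snd x / 2" "real n"] obtain v \<epsilon> where
      v: "v \<in> V" "N (v - fst x) < snd x / 2" "\<epsilon> > 0" "\<forall>a\<in>V. q a \<le> real n \<longrightarrow> \<epsilon> \<le> N (v - a)"
      by auto
    with x show "\<exists>y. (fst y \<in> V \<and> 0 < snd y) \<and> N (fst y - fst x) < snd x / 2 \<and>
        snd y \<le> snd x / 2 \<and> (\<forall>a\<in>V. q a \<le> real n \<longrightarrow> 2 * snd y \<le> N (fst y - a))"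
      by (intro exI[of _ "(v, min (\<epsilon> / 2) (snd x / 2))"]) (simp add: min_le_iff_disj; force)
  qed
  then obtain f where f: "\<And>n. fst (f n) \<in> V" "\<And>n. snd (f n) > 0"
     "\<And>n. N (fst (f (Suc n)) - fst (f n)) < snd (f n) / 2" "\<And>n. snd (f (Suc n)) \<le> snd (f n) / 2"
     "\<And>n a. a \<in> V \<Longrightarrow> q a \<le> real n \<Longrightarrow> 2 * snd (f (Suc n)) \<le> N (fst (f (Suc n)) - a)"
    by metis
  define w r where "w n = fst (f n)" and "r n = snd (f n)" for n
  have w: "w n \<in> V" and r: "r n > 0" "N (w (Suc n) - w n) < r n / 2" "r (Suc n) \<le> r n / 2"
    and avoid: "\<And>a. a \<in> V \<Longrightarrow> q a \<le> real n \<Longrightarrow> 2 * r (Suc n) \<le> N (w (Suc n) - a)" for n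
    using f by (auto simp: w_def r_def)
  have "(\<Sum>k<n. N (w (Suc k) - w k)) \<le> r 0 - r n" for n
  proof (induction n)
    case (Suc n)
    with r(2,3)[of n] show ?case by simp
  qed simp
  then have "(\<Sum>k<n. N (w (Suc k) - w k)) \<le> r 0" for n
    using r(1)[of n] by (smt (verit))
  then have "summable (\<lambda>k. N (w (Suc k) - w k))"
    by (intro summableI_nonneg_bounded N_nonneg V_intros w)
  then obtain v where v: "v \<in> V" "(\<lambda>n. N (v - (\<Sum>k<n. w (Suc k) - w k))) \<longlonglongrightarrow> 0"
    using N_complete[of "\<lambda>k. w (Suc k) - w k"] by (auto intro: V_intros w)
  define z where "z = v + w 0"
  have z: "z \<in> V" by (auto simp: z_def intro: V_intros w v)
  have lim: "(\<lambda>n. N (z - w n)) \<longlonglongrightarrow> 0"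
    using v(2) by (simp add: sum_lessThan_telescope z_def algebra_simps)
  have near: "N (w (n + k) - w n) \<le> r n - r (n + k)" for n k
  proof (induction k)
    case 0 then show ?case by (simp add: N_zero)
  next
    case (Suc k)
    have "N (w (n + Suc k) - w n) \<le> N (w (n + Suc k) - w (n + k)) + N (w (n + k) - w n)"
      by (intro N_triangle_sub w)
    with Suc r(2,3)[of "n + k"] show ?case by simp
  qed
  have zn: "N (z - w n) \<le> r n" for n
  proof (rule LIMSEQ_le_const)
    show "(\<lambda>k. N (z - w (k + n)) + r n) \<longlonglongrightarrow> r n"
      using tendsto_add[OF LIMSEQ_ignore_initial_segment[OF lim, of n] tendsto_const] by simp
    have "N (z - w n) \<le> N (z - w (k + n)) + r n" for k
      using N_triangle_sub[OF z, of "w (k + n)" "w n"] near[of n k] r(1)[of "n+k"] w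
      by (simp add: add.commute)
    then show "\<exists>M. \<forall>k\<ge>M. N (z - w n) \<le> N (z - w (k + n)) + r n" by blast
  qed
  obtain n where "q z \<le> real n" using real_arch_simple by blast
  from avoid[OF z this] zn[of "Suc n"] r(1)[of "Suc n"] N_minus_commute[OF z w, of "Suc n"]
  show False by linarith
qed

lemma zabreiko:
  fixes q :: "'v \<Rightarrow> real"
  assumes q_nonneg: "\<And>v. v \<in> V \<Longrightarrow> 0 \<le> q v"
    and q_scale: "\<And>c v. v \<in> V \<Longrightarrow> q (c *c v) = cmod c * q v"
    and q_subadd: "\<And>u v. (\<And>n. u n \<in> V) \<Longrightarrow> v \<in> V \<Longrightarrow> summable (\<lambda>n::nat. q (u n)) \<Longrightarrow>
      (\<lambda>n. N (v - (\<Sum>k<n. u k))) \<longlonglongrightarrow> 0 \<Longrightarrow> q v \<le> (\<Sum>n. q (u n))"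
  shows "\<exists>K\<ge>0. \<forall>v\<in>V. q v \<le> K * N v"
proof -
  have q0: "q 0 = 0" using q_scale[of 0 0] V_intros(1) by simp
  \<comment> \<open>Countable subadditivity is applied to the sequence \<open>a\<close>,
    \<open>- b\<close>, 0, 0, and so on; homogeneity gives \<open>q (- b) = q b\<close>.\<close>
  have q_diff: "q (a - b) \<le> q a + q b" if "a \<in> V" "b \<in> V" for a b
  proof -
    define u where "u = (\<lambda>n::nat. if n = 0 then a else if n = 1 then - b else 0)"
    have eq: "(\<Sum>k<n. u k) = a - b" if "n \<ge> 2" for n
    proof -
      have "(\<Sum>k<n. u k) = (\<Sum>k<2. u k)"
        by (rule sum.mono_neutral_right) (use that in \<open>auto simp: u_def\<close>)
      then show ?thesis by (simp add: u_def numeral_2_eq_2)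
    qed
    have mb: "- b \<in> V" "q (- b) = q b"
      using q_scale[OF that(2), of "-1"] V_intros(4)[OF that(2), of "-1"] by (simp_all add: scale_minus_left)
    have s: "(\<lambda>n. q (u n)) sums (q a + q b)"
      using sums_finite[of "{0,1}" "\<lambda>n. q (u n)"] by (simp add: u_def q0 mb)
    have "q (a - b) \<le> (\<Sum>n. q (u n))"
    proof (rule q_subadd)
      show "u n \<in> V" for n using that mb V_intros(1) by (auto simp: u_def)
      show "(\<lambda>n. N (a - b - (\<Sum>k<n. u k))) \<longlonglongrightarrow> 0"
        by (rule tendsto_eventually)
           (use eq in \<open>auto simp: eventually_sequentially N_zero intro!: exI[of _ 2]\<close>)
    qed (use that s in \<open>auto intro: V_intros sums_summable\<close>)
    with s show ?thesis by (simp add: sums_iff)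
  qed
  obtain m w r where w: "w \<in> V" and r: "r > 0" and
    dense: "\<And>v \<epsilon>. v \<in> V \<Longrightarrow> N (v - w) < r \<Longrightarrow> \<epsilon> > 0 \<Longrightarrow> \<exists>a\<in>V. q a \<le> m \<and> N (v - a) < \<epsilon>"
    using zabreiko_dense_ball[of q] by blast
  define C where "C = 2 * m / r"
  have m: "m \<ge> 0"
    using dense[OF w, of 1] r q_nonneg by (fastforce simp: N_zero)
  have C: "C \<ge> 0" using m r by (simp add: C_def)
  \<comment> \<open>Scale \<open>v\<close> into the ball of radius \<open>r\<close>. Both
    \<open>w + v'\<close> and \<open>w\<close> are approximated by points with \<open>q\<close> at
    most \<open>m\<close>, so \<open>v'\<close> is approximated by differences with \<open>q\<close>
    at most \<open>2 * m\<close>. Undoing the scaling produces the factor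
    \<open>C = 2 * m / r\<close>.\<close>
  have approx: "\<exists>a\<in>V. q a \<le> C * \<eta> \<and> N (v - a) < \<epsilon>"
    if v: "v \<in> V" "N v < \<eta>" and \<epsilon>: "\<epsilon> > 0" for v \<eta> \<epsilon>
  proof -
    have \<eta>: "\<eta> > 0" using N_nonneg[OF v(1)] v(2) by linarith
    define s where "s = r / \<eta>"
    have s: "s > 0" using r \<eta> by (simp add: s_def)
    define v' where "v' = complex_of_real s *c v"
    have v': "v' \<in> V" "N v' < r"
      using v s r \<eta> by (auto simp: v'_def V_intros N_scale s_def norm_divide field_simps)
    have "s * \<epsilon> / 2 > 0" using s \<epsilon> by simp
    then obtain a b where a: "a \<in> V" "q a \<le> m" "N (w + v' - a) < s * \<epsilon> / 2"
      and b: "b \<in> V" "q b \<le> m" "N (w - b) < s * \<epsilon> / 2"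
      using dense[of "w + v'" "s * \<epsilon> / 2"] dense[of w "s * \<epsilon> / 2"] w v' r by (auto simp: N_zero V_intros)
    define d where "d = complex_of_real (1 / s) *c (a - b)"
    have ab: "a - b \<in> V" by (intro V_intros a b)
    have "q d = q (a - b) / s" using q_scale[OF ab] s by (simp add: d_def norm_divide)
    also have "\<dots> \<le> 2 * m / s"
      using q_diff[OF a(1) b(1)] a(2) b(2) s by (intro divide_right_mono) auto
    also have "\<dots> = C * \<eta>" using r \<eta> by (simp add: C_def s_def)
    finally have qd: "q d \<le> C * \<eta>" .
    have vd: "v - d = complex_of_real (1 / s) *c ((w + v' - a) - (w - b))"
      using s by (simp add: d_def v'_def scale_right_diff_distrib scale_right_distrib algebra_simps
          flip: of_real_mult of_real_divide)
    have mem: "w + v' - a \<in> V" "w - b \<in> V" by (intro V_intros a b w v')+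
    have "N (v - d) = N ((w + v' - a) - (w - b)) / s"
      unfolding vd using s N_scale[OF subspace_diff[OF subspace_V mem]] by (simp add: norm_divide)
    also have "\<dots> \<le> (N (w + v' - a) + N (w - b)) / s"
      using N_diff_le[OF mem] s by (intro divide_right_mono) auto
    also have "\<dots> < (s * \<epsilon>) / s"
      using a(3) b(3) s by (intro divide_strict_right_mono) auto
    finally have "N (v - d) < \<epsilon>" using s by simp
    with qd show ?thesis using ab by (intro bexI[of _ d]) (auto simp: d_def V_intros)
  qed
  have bound: "q v \<le> 2 * C * \<eta>" if v: "v \<in> V" "N v < \<eta>" for v \<eta>
  proof -
    have \<eta>: "\<eta> > 0" using N_nonneg[OF v(1)] v(2) by linarith
    \<comment> \<open>The \<open>f n\<close> are the residuals and \<open>f n - f (Suc n)\<close>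
      the approximants. The clause for \<open>n = 0\<close> pins the starting point, which dependent
      choice alone leaves open.\<close>
    have "\<exists>f. \<forall>n::nat. (f n \<in> V \<and> N (f n) < \<eta> / 2 ^ n \<and> (n = 0 \<longrightarrow> f n = v)) \<and>
      q (f n - f (Suc n)) \<le> C * (\<eta> / 2 ^ n)"
    proof (rule dependent_nat_choice)
      show "\<exists>x. x \<in> V \<and> N x < \<eta> / 2 ^ 0 \<and> (0 = (0::nat) \<longrightarrow> x = v)" using v by auto
    next
      fix x and n :: nat
      assume x: "x \<in> V \<and> N x < \<eta> / 2 ^ n \<and> (n = 0 \<longrightarrow> x = v)"
      with approx[of x "\<eta> / 2 ^ n" "\<eta> / 2 ^ Suc n"] \<eta> obtain a where
        "a \<in> V" "q a \<le> C * (\<eta> / 2 ^ n)" "N (x - a) < \<eta> / 2 ^ Suc n" by auto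
      with x show "\<exists>y. (y \<in> V \<and> N y < \<eta> / 2 ^ Suc n \<and> (Suc n = 0 \<longrightarrow> y = v)) \<and>
          q (x - y) \<le> C * (\<eta> / 2 ^ n)"
        by (intro exI[of _ "x - a"]) (auto simp: V_intros)
    qed
    then obtain f where f: "\<And>n. f n \<in> V" "\<And>n. N (f n) < \<eta> / 2 ^ n" "f 0 = v"
      "\<And>n. q (f n - f (Suc n)) \<le> C * (\<eta> / 2 ^ n)" by metis
    have geo: "(\<lambda>n. C * (\<eta> / 2 ^ n)) sums (2 * C * \<eta>)"
      using sums_mult[OF geometric_sums[of "1 / 2 :: real"], of "C * \<eta>"] by (simp add: power_divide ac_simps)
    have sq: "summable (\<lambda>n. q (f n - f (Suc n)))"
      using f by (intro summable_comparison_test'[OF sums_summable[OF geo], of 0])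
        (simp add: abs_of_nonneg q_nonneg V_intros)
    have "q v \<le> (\<Sum>n. q (f n - f (Suc n)))"
    proof (rule q_subadd)
      have "(\<lambda>n. \<eta> / 2 ^ n) \<longlonglongrightarrow> 0"
        using tendsto_mult_right_zero[OF LIMSEQ_realpow_zero[of "1/2::real"], of \<eta>] by (simp add: power_divide)
      then have "(\<lambda>n. N (f n)) \<longlonglongrightarrow> 0"
        by (rule tendsto_sandwich[OF _ _ tendsto_const, rotated 2])
           (use f(1,2) in \<open>auto intro!: always_eventually N_nonneg intro: less_imp_le\<close>)
      then show "(\<lambda>n. N (v - (\<Sum>k<n. f k - f (Suc k)))) \<longlonglongrightarrow> 0"
        by (simp add: sum_lessThan_telescope' f(3))
    qed (use f v sq in \<open>auto intro: V_intros\<close>)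
    also have "\<dots> \<le> 2 * C * \<eta>"
      using suminf_le[OF f(4) sq sums_summable[OF geo]] geo by (simp add: sums_iff)
    finally show ?thesis .
  qed
  have "q v \<le> 2 * C * N v" if v: "v \<in> V" for v
  proof (rule field_le_epsilon)
    fix e :: real assume e: "e > 0"
    \<comment> \<open>\<open>bound\<close> requires a number strictly above \<open>N v\<close>; this
      surplus contributes at most \<open>e\<close>, also when \<open>C\<close> is 0.\<close>
    have "q v \<le> 2 * C * (N v + e / (2 * C + 1))"
      using bound[OF v, of "N v + e / (2 * C + 1)"] e C by simp
    also have "\<dots> \<le> 2 * C * N v + e"
      using e C by (simp add: field_simps)
    finally show "q v \<le> 2 * C * N v + e" .
  qed
  with C show ?thesis by (intro exI[of _ "2 * C"]) auto
qed

text \<open>Zabreiko's lemma will be applied on a closed span, which therefore has to be complete by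
  itself. A limit of points of the closure is approximated first by a partial sum and then by a
  point of \<open>W\<close>.\<close>

lemma complete_seminormed_closure:
  assumes W: "subspace W" "W \<subseteq> V"
  shows "complete_seminormed sc {f \<in> V. \<forall>\<epsilon>>0. \<exists>w\<in>W. N (f - w) < \<epsilon>} N"
proof -
  define C where "C = {f \<in> V. \<forall>\<epsilon>>0. \<exists>w\<in>W. N (f - w) < \<epsilon>}"
  have C_V: "f \<in> V" if "f \<in> C" for f using that by (simp add: C_def)
  have C_approx: "\<exists>w\<in>W. N (f - w) < \<epsilon>" if "f \<in> C" "\<epsilon> > 0" for f \<epsilon>
    using that by (simp add: C_def)
  have C_I: "f \<in> C" if "f \<in> V" "\<And>\<epsilon>. \<epsilon> > 0 \<Longrightarrow> \<exists>w\<in>W. N (f - w) < \<epsilon>" for f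
    using that by (simp add: C_def)
  have W_V: "w \<in> V" if "w \<in> W" for w using W(2) that by (rule subsetD)
  have sub: "subspace C"
  proof (rule subspaceI)
    show "0 \<in> C"
      by (intro C_I bexI[of _ 0] subspace_0 W subspace_V) (simp add: N_zero)
  next
    fix f g assume f: "f \<in> C" and g: "g \<in> C"
    show "f + g \<in> C"
    proof (rule C_I)
      show "f + g \<in> V" using f g by (intro V_intros C_V)
      fix \<epsilon> :: real assume "\<epsilon> > 0"
      then have "\<epsilon> / 2 > 0" by simp
      then obtain a b where a: "a \<in> W" "N (f - a) < \<epsilon> / 2" and b: "b \<in> W" "N (g - b) < \<epsilon> / 2"
        using C_approx[OF f] C_approx[OF g] by metis
      have "N (f - a + (g - b)) \<le> N (f - a) + N (g - b)"
        using f g a b by (intro N_triangle V_intros C_V W_V)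
      then have "N (f + g - (a + b)) < \<epsilon>" using a b by (simp add: add_diff_add)
      then show "\<exists>w\<in>W. N (f + g - w) < \<epsilon>"
        using subspace_add[OF W(1) a(1) b(1)] by (rule bexI)
    qed
  next
    fix c f assume f: "f \<in> C"
    show "c *c f \<in> C"
    proof (rule C_I)
      show "c *c f \<in> V" using f by (intro V_intros C_V)
      fix \<epsilon> :: real assume \<epsilon>: "\<epsilon> > 0"
      \<comment> \<open>The added 1 covers \<open>c = 0\<close>.\<close>
      have M: "cmod c + 1 > 0" by (simp add: add_nonneg_pos)
      with \<epsilon> have "\<epsilon> / (cmod c + 1) > 0" by simp
      from C_approx[OF f this] obtain a where a: "a \<in> W" "N (f - a) < \<epsilon> / (cmod c + 1)" by (elim bexE)
      have fa: "f - a \<in> V" using C_V[OF f] W_V[OF a(1)] by (rule V_intros)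
      have "N (c *c f - c *c a) = cmod c * N (f - a)"
        using N_scale[OF fa] by (simp add: scale_right_diff_distrib)
      also have "\<dots> \<le> (cmod c + 1) * N (f - a)"
        using N_nonneg[OF fa] by (intro mult_right_mono) auto
      also have "\<dots> < \<epsilon>" using a(2) M by (simp add: pos_less_divide_eq mult.commute)
      finally show "\<exists>w\<in>W. N (c *c f - w) < \<epsilon>"
        using subspace_scale[OF W(1) a(1)] by (rule bexI)
    qed
  qed
  have "complete_seminormed sc C N"
  proof (unfold_locales)
    show "subspace C" by (rule sub)
  next
    fix h :: "nat \<Rightarrow> 'v"
    assume h: "\<And>n. h n \<in> C" and s: "summable (\<lambda>n. N (h n))"
    obtain v where v: "v \<in> V" and lim: "(\<lambda>n. N (v - (\<Sum>k<n. h k))) \<longlonglongrightarrow> 0"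
      using N_complete[OF C_V[OF h] s] by (elim bexE)
    have "v \<in> C"
    proof (rule C_I[OF v])
      fix \<epsilon> :: real assume "\<epsilon> > 0"
      then have e2: "\<epsilon> / 2 > 0" by simp
      obtain n where n: "N (v - (\<Sum>k<n. h k)) < \<epsilon> / 2"
        using eventually_happens'[OF sequentially_bot order_tendstoD(2)[OF lim e2]] by (elim exE)
      have S: "(\<Sum>k<n. h k) \<in> C" by (intro subspace_sum[OF sub] h)
      from C_approx[OF S e2] obtain w where w: "w \<in> W" "N ((\<Sum>k<n. h k) - w) < \<epsilon> / 2" by (elim bexE)
      have "N (v - w) \<le> N (v - (\<Sum>k<n. h k)) + N ((\<Sum>k<n. h k) - w)"
        using v C_V[OF S] W_V[OF w(1)] by (rule N_triangle_sub)
      with n w(2) have "N (v - w) < \<epsilon>" by simp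
      then show "\<exists>w\<in>W. N (v - w) < \<epsilon>" using w(1) by (rule bexI)
    qed
    with lim show "\<exists>v\<in>C. (\<lambda>n. N (v - (\<Sum>k<n. h k))) \<longlonglongrightarrow> 0" by (rule bexI)
  qed (use C_V in \<open>auto intro: N_nonneg N_triangle simp: N_scale\<close>)
  then show ?thesis by (simp add: C_def)
qed

end

section \<open>The unconditionality constant\<close>

locale unique_unconditional_expansions = complete_seminormed sc V N
  for sc :: "complex \<Rightarrow> 'v::ab_group_add \<Rightarrow> 'v" (infixr \<open>*c\<close> 75) and V N +
  fixes x :: "'i \<Rightarrow> 'v" and I :: "'i set"
  assumes x_in_V: "i \<in> I \<Longrightarrow> x i \<in> V"
    and unique_expansion: "f \<in> V \<Longrightarrow> \<exists>!c. (\<forall>i. i \<notin> I \<longrightarrow> c i = 0) \<and>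
      (\<forall>\<epsilon>>0. \<exists>F0. finite F0 \<and> F0 \<subseteq> I \<and>
        (\<forall>F. finite F \<and> F0 \<subseteq> F \<and> F \<subseteq> I \<longrightarrow> N (f - (\<Sum>i\<in>F. c i *c x i)) < \<epsilon>))"
begin

definition expands :: "('i \<Rightarrow> complex) \<Rightarrow> 'v \<Rightarrow> bool" where
  "expands c f \<longleftrightarrow> (\<forall>\<epsilon>>0. \<exists>F0. finite F0 \<and> F0 \<subseteq> I \<and>
     (\<forall>F. finite F \<and> F0 \<subseteq> F \<and> F \<subseteq> I \<longrightarrow> N (f - (\<Sum>i\<in>F. c i *c x i)) < \<epsilon>))"

definition coord :: "'v \<Rightarrow> 'i \<Rightarrow> complex" where
  "coord f = (THE c. (\<forall>i. i \<notin> I \<longrightarrow> c i = 0) \<and> expands c f)"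

definition proj :: "'i set \<Rightarrow> 'v \<Rightarrow> 'v" where
  "proj F f = (\<Sum>i\<in>F. coord f i *c x i)"

text \<open>The classical renorming under which all partial-sum projections are contractions. As a
  supremum of reals it acquires its meaning from \<open>proj_bounded\<close>.\<close>

definition sup_proj :: "'v \<Rightarrow> real" where
  "sup_proj f = (SUP F\<in>{F. finite F \<and> F \<subseteq> I}. N (proj F f))"

lemma sum_in_V: "F \<subseteq> I \<Longrightarrow> (\<Sum>i\<in>F. c i *c x i) \<in> V"
  by (auto intro!: V_intros x_in_V)

lemma proj_in_V: "F \<subseteq> I \<Longrightarrow> proj F f \<in> V"
  by (simp add: proj_def sum_in_V)

lemma
  assumes "f \<in> V"
  shows coord_outside: "i \<notin> I \<Longrightarrow> coord f i = 0" and expands_coord: "expands (coord f) f"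
proof -
  have "(\<forall>i. i \<notin> I \<longrightarrow> coord f i = 0) \<and> expands (coord f) f"
    unfolding coord_def expands_def by (rule theI'[OF unique_expansion[OF assms]])
  then show "i \<notin> I \<Longrightarrow> coord f i = 0" "expands (coord f) f" by simp_all
qed

lemma proj_approx:
  assumes "f \<in> V" "\<epsilon> > 0"
  obtains F0 where "finite F0" "F0 \<subseteq> I"
    "\<And>F. finite F \<Longrightarrow> F0 \<subseteq> F \<Longrightarrow> F \<subseteq> I \<Longrightarrow> N (f - proj F f) < \<epsilon>"
proof -
  have "\<exists>F0. finite F0 \<and> F0 \<subseteq> I \<and>
      (\<forall>F. finite F \<and> F0 \<subseteq> F \<and> F \<subseteq> I \<longrightarrow> N (f - proj F f) < \<epsilon>)"
    unfolding proj_def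
    by (rule expands_coord[OF assms(1), unfolded expands_def, rule_format, OF assms(2)])
  then obtain F0 where "finite F0" "F0 \<subseteq> I"
    "\<forall>F. finite F \<and> F0 \<subseteq> F \<and> F \<subseteq> I \<longrightarrow> N (f - proj F f) < \<epsilon>" by (elim exE conjE)
  then show ?thesis by (intro that[of F0]) simp_all
qed

lemma coord_eqI:
  assumes "f \<in> V" "\<And>i. i \<notin> I \<Longrightarrow> c i = 0" "expands c f"
  shows "coord f = c"
  unfolding coord_def expands_def
  by (rule the1_equality[OF unique_expansion[OF assms(1)]]) (use assms(2,3) in \<open>simp add: expands_def\<close>)

lemma coord_scale: assumes f: "f \<in> V" shows "coord (a *c f) = (\<lambda>i. a * coord f i)"
proof (rule coord_eqI)
  show "expands (\<lambda>i. a * coord f i) (a *c f)"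
    unfolding expands_def
  proof (intro allI impI)
    fix \<epsilon> :: real assume \<epsilon>: "\<epsilon> > 0"
    have M: "cmod a + 1 > 0" by (simp add: add_nonneg_pos)
    with \<epsilon> have "\<epsilon> / (cmod a + 1) > 0" by simp
    from proj_approx[OF f this] obtain F0 where F0: "finite F0" "F0 \<subseteq> I"
      "\<And>F. finite F \<Longrightarrow> F0 \<subseteq> F \<Longrightarrow> F \<subseteq> I \<Longrightarrow> N (f - proj F f) < \<epsilon> / (cmod a + 1)"
      by metis
    have "N (a *c f - (\<Sum>i\<in>F. (a * coord f i) *c x i)) < \<epsilon>"
      if F: "finite F" "F0 \<subseteq> F" "F \<subseteq> I" for F
    proof -
      have "a *c f - (\<Sum>i\<in>F. (a * coord f i) *c x i) = a *c (f - proj F f)"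
        by (simp add: proj_def scale_right_diff_distrib scale_sum_right)
      then have "N (a *c f - (\<Sum>i\<in>F. (a * coord f i) *c x i)) = cmod a * N (f - proj F f)"
        using F by (simp add: N_scale V_intros f proj_in_V)
      also have "\<dots> \<le> (cmod a + 1) * N (f - proj F f)"
        using F by (intro mult_right_mono N_nonneg V_intros f proj_in_V) auto
      also have "\<dots> < \<epsilon>"
        using F0(3)[OF F] M by (simp add: pos_less_divide_eq mult.commute)
      finally show ?thesis .
    qed
    with F0(1,2) show "\<exists>F0. finite F0 \<and> F0 \<subseteq> I \<and> (\<forall>F. finite F \<and> F0 \<subseteq> F \<and> F \<subseteq> I \<longrightarrow>
        N (a *c f - (\<Sum>i\<in>F. (a * coord f i) *c x i)) < \<epsilon>)"
      by (intro exI[of _ F0]) simp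
  qed
qed (use f coord_outside in \<open>auto intro: V_intros\<close>)

lemma coord_finite_sum:
  assumes F: "finite F" "F \<subseteq> I"
  shows "coord (\<Sum>i\<in>F. a i *c x i) = (\<lambda>i. if i \<in> F then a i else 0)"
proof (rule coord_eqI)
  have "(\<Sum>i\<in>F'. (if i \<in> F then a i else 0) *c x i) = (\<Sum>i\<in>F. a i *c x i)" if "finite F'" "F \<subseteq> F'" for F'
    using that by (intro sum.mono_neutral_cong_right) auto
  then show "expands (\<lambda>i. if i \<in> F then a i else 0) (\<Sum>i\<in>F. a i *c x i)"
    unfolding expands_def using F by (intro allI impI exI[of _ F]) (simp add: N_zero)
qed (use F in \<open>auto intro: sum_in_V\<close>)

text \<open>If \<open>x i\<close> had seminorm 0, the vector 0 would have two expansions: one with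
  all coefficients zero and one with the indicator of \<open>i\<close>.\<close>

lemma N_x_pos: assumes i: "i \<in> I" shows "N (x i) > 0"
proof (rule ccontr)
  assume "\<not> N (x i) > 0"
  with N_nonneg[OF x_in_V[OF i]] have Nx: "N (x i) = 0" by simp
  have "coord 0 = (\<lambda>j. if j = i then 1 else 0)"
  proof (rule coord_eqI)
    have "N (0 - (\<Sum>j\<in>F. (if j = i then 1 else 0) *c x j)) = 0" if "finite F" "{i} \<subseteq> F" for F
    proof -
      have "(\<Sum>j\<in>F. (if j = i then 1 else 0) *c x j) = (\<Sum>j\<in>{i}. 1 *c x j)"
        using that by (intro sum.mono_neutral_cong_right) auto
      then show ?thesis
        using N_minus_commute[of 0 "x i"] Nx x_in_V[OF i] V_intros(1) by simp
    qed
    then show "expands (\<lambda>j. if j = i then 1 else 0) 0"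
      unfolding expands_def using i by (intro allI impI exI[of _ "{i}"]) auto
  qed (use i V_intros(1) in auto)
  moreover have "coord 0 = (\<lambda>_. 0)"
    using coord_finite_sum[of "{}"] by simp
  ultimately show False by (metis zero_neq_one)
qed

text \<open>Partial sums over sets containing \<open>F0\<close> stay within 1 of \<open>f\<close>.
  Any other is the sum over \<open>F \<union> F0\<close> minus the one over \<open>F0 - F\<close>,
  and the latter is controlled by the finitely many terms of \<open>F0\<close>.\<close>

lemma proj_bounded:
  assumes f: "f \<in> V"
  shows "\<exists>B. \<forall>F. finite F \<and> F \<subseteq> I \<longrightarrow> N (proj F f) \<le> B"
proof -
  obtain F0 where F0: "finite F0" "F0 \<subseteq> I"
    "\<And>F. finite F \<Longrightarrow> F0 \<subseteq> F \<Longrightarrow> F \<subseteq> I \<Longrightarrow> N (f - proj F f) < 1"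
    using proj_approx[OF f zero_less_one] by metis
  have "N (proj F f) \<le> (N f + 1) + (\<Sum>i\<in>F0. N (coord f i *c x i))" if F: "finite F" "F \<subseteq> I" for F
  proof -
    have "proj (F \<union> F0) f = proj F f + proj (F0 - F) f"
      unfolding proj_def using F F0 by (subst sum.union_disjoint[symmetric]) (auto intro: sum.cong)
    then have "N (proj F f) \<le> N (proj (F \<union> F0) f) + N (proj (F0 - F) f)"
      using N_diff_le[of "proj (F \<union> F0) f" "proj (F0 - F) f"] F F0
        proj_in_V[of "F \<union> F0" f] proj_in_V[of "F0 - F" f] by auto
    also have "N (proj (F \<union> F0) f) \<le> N f + 1"
    proof -
      have "N (proj (F \<union> F0) f) \<le> N f + N (f - proj (F \<union> F0) f)"
        using N_diff_le[of f "f - proj (F \<union> F0) f"] F F0 f by (simp add: V_intros proj_in_V)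
      moreover have "N (f - proj (F \<union> F0) f) < 1" using F F0(1,2) by (intro F0(3)) auto
      ultimately show ?thesis by simp
    qed
    also have "N (proj (F0 - F) f) \<le> (\<Sum>i\<in>F0 - F. N (coord f i *c x i))"
      unfolding proj_def using F0 by (intro N_sum V_intros x_in_V) auto
    also have "\<dots> \<le> (\<Sum>i\<in>F0. N (coord f i *c x i))"
      using F0 by (intro sum_mono2) (auto intro!: N_nonneg V_intros x_in_V)
    finally show ?thesis by simp
  qed
  then show ?thesis by blast
qed

lemma N_proj_le: assumes "f \<in> V" "finite F" "F \<subseteq> I" shows "N (proj F f) \<le> sup_proj f"
proof -
  obtain B where "\<And>F. finite F \<Longrightarrow> F \<subseteq> I \<Longrightarrow> N (proj F f) \<le> B"
    using proj_bounded[OF assms(1)] by blast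
  then have "bdd_above ((\<lambda>F. N (proj F f)) ` {F. finite F \<and> F \<subseteq> I})"
    by (auto intro!: bdd_aboveI[of _ B])
  with assms show ?thesis unfolding sup_proj_def by (intro cSUP_upper) auto
qed

lemma sup_proj_leI: "(\<And>F. finite F \<Longrightarrow> F \<subseteq> I \<Longrightarrow> N (proj F f) \<le> B) \<Longrightarrow> sup_proj f \<le> B"
  unfolding sup_proj_def by (rule cSUP_least) auto

lemma sup_proj_nonneg: "f \<in> V \<Longrightarrow> 0 \<le> sup_proj f"
  using N_proj_le[of f "{}"] by (simp add: proj_def N_zero)

lemma sup_proj_scale: assumes f: "f \<in> V" shows "sup_proj (a *c f) = cmod a * sup_proj f"
proof -
  have p: "proj F (b *c g) = b *c proj F g" if "g \<in> V" for F b g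
    using that by (simp add: proj_def coord_scale scale_sum_right)
  have le: "sup_proj (b *c g) \<le> cmod b * sup_proj g" if g: "g \<in> V" for b g
    by (rule sup_proj_leI) (use g in \<open>simp add: p N_scale proj_in_V mult_left_mono N_proj_le\<close>)
  show ?thesis
  proof (cases "a = 0")
    case True
    with f show ?thesis using le[of 0 0] sup_proj_nonneg[of 0] V_intros(1) by simp
  next
    case False
    with le[of "a *c f" "1 / a"] f have "sup_proj f \<le> cmod (1 / a) * sup_proj (a *c f)"
      by (simp add: V_intros)
    with False le[OF f, of a] show ?thesis by (simp add: norm_divide field_simps)
  qed
qed

text \<open>A one-term projection isolates a coefficient. By this bound, vectors with summable
  \<open>sup_proj\<close> have absolutely summable coefficients at each index.\<close>

lemma cmod_coord_le:
  assumes "f \<in> V" "i \<in> I" shows "cmod (coord f i) \<le> sup_proj f / N (x i)"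
  using N_proj_le[of f "{i}"] N_x_pos[OF assms(2)] assms
  by (simp add: proj_def N_scale x_in_V field_simps)

text \<open>For a fixed finite \<open>F\<close> the sum depends continuously on its coefficients, so
  a bound uniform in \<open>m\<close> passes to the limit.\<close>

lemma N_sum_le_limit:
  assumes F: "finite F" "F \<subseteq> I" and d: "\<And>i. i \<in> F \<Longrightarrow> (\<lambda>m. d m i) \<longlonglongrightarrow> c i"
    and le: "\<And>m. N (\<Sum>i\<in>F. d m i *c x i) \<le> B"
  shows "N (\<Sum>i\<in>F. c i *c x i) \<le> B"
proof (rule LIMSEQ_le_const)
  have "(\<lambda>m. \<Sum>i\<in>F. cmod (c i - d m i) * N (x i)) \<longlonglongrightarrow> (\<Sum>i\<in>F. cmod (c i - c i) * N (x i))"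
    by (intro tendsto_intros d)
  then show "(\<lambda>m. (\<Sum>i\<in>F. cmod (c i - d m i) * N (x i)) + B) \<longlonglongrightarrow> B"
    using tendsto_add[OF _ tendsto_const[of B]] by fastforce
  have "N (\<Sum>i\<in>F. c i *c x i) \<le> (\<Sum>i\<in>F. cmod (c i - d m i) * N (x i)) + B" for m
  proof -
    have "(\<Sum>i\<in>F. c i *c x i) = (\<Sum>i\<in>F. (c i - d m i) *c x i) + (\<Sum>i\<in>F. d m i *c x i)"
      by (simp add: scale_left_diff_distrib sum_subtractf)
    then have "N (\<Sum>i\<in>F. c i *c x i) \<le> N (\<Sum>i\<in>F. (c i - d m i) *c x i) + N (\<Sum>i\<in>F. d m i *c x i)"
      using F by (metis N_triangle sum_in_V)
    also have "N (\<Sum>i\<in>F. (c i - d m i) *c x i) \<le> (\<Sum>i\<in>F. N ((c i - d m i) *c x i))"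
      using F by (intro N_sum V_intros x_in_V) auto
    also have "\<dots> = (\<Sum>i\<in>F. cmod (c i - d m i) * N (x i))"
      using F by (intro sum.cong) (auto simp: N_scale x_in_V)
    finally show ?thesis using le[of m] by simp
  qed
  then show "\<exists>M. \<forall>m\<ge>M. N (\<Sum>i\<in>F. c i *c x i) \<le> (\<Sum>i\<in>F. cmod (c i - d m i) * N (x i)) + B" by blast
qed

text \<open>The summed coefficients are not yet known to belong to a vector of \<open>V\<close>. The
  estimate serves twice: for the tails in \<open>coord_series\<close>, and for the countable
  subadditivity of \<open>sup_proj\<close> once \<open>coord_series\<close> has identified these
  coefficients.\<close>

lemma N_proj_sum_le:
  assumes u: "\<And>n. u n \<in> V" and s: "summable (\<lambda>n::nat. sup_proj (u n))" and F: "finite F" "F \<subseteq> I"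
  shows "N (\<Sum>i\<in>F. (\<Sum>n. coord (u n) i) *c x i) \<le> (\<Sum>n. sup_proj (u n))"
proof (rule N_sum_le_limit[OF F])
  fix i assume i: "i \<in> F"
  have "summable (\<lambda>n. coord (u n) i)"
    by (rule summable_comparison_test'[OF summable_divide[OF s, of "N (x i)"]])
       (use u i F cmod_coord_le in auto)
  then show "(\<lambda>m. \<Sum>n<m. coord (u n) i) \<longlonglongrightarrow> (\<Sum>n. coord (u n) i)"
    by (rule summable_LIMSEQ)
next
  fix m
  have "(\<Sum>i\<in>F. (\<Sum>n<m. coord (u n) i) *c x i) = (\<Sum>n<m. proj F (u n))"
    unfolding proj_def scale_sum_left by (rule sum.swap)
  then have "N (\<Sum>i\<in>F. (\<Sum>n<m. coord (u n) i) *c x i) \<le> (\<Sum>n<m. N (proj F (u n)))"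
    using N_sum[of "{..<m}" "\<lambda>n. proj F (u n)"] F by (simp add: proj_in_V)
  also have "\<dots> \<le> (\<Sum>n<m. sup_proj (u n))"
    by (intro sum_mono N_proj_le u F)
  also have "\<dots> \<le> (\<Sum>n. sup_proj (u n))"
    by (intro sum_le_suminf s) (auto intro: sup_proj_nonneg u)
  finally show "N (\<Sum>i\<in>F. (\<Sum>n<m. coord (u n) i) *c x i) \<le> (\<Sum>n. sup_proj (u n))" .
qed

text \<open>Uniqueness plays the role of a closed graph: it suffices that the termwise sums of the
  coefficients expand \<open>v\<close>. The error has three parts: the remainder of the series for
  \<open>v\<close>, the projection errors of its first \<open>n\<close> terms, and a tail of
  coefficients bounded by the tail of the \<open>sup_proj\<close> series.\<close>

lemma coord_series:
  assumes u: "\<And>n. u n \<in> V" and v: "v \<in> V" and s: "summable (\<lambda>n::nat. sup_proj (u n))"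
    and lim: "(\<lambda>n. N (v - (\<Sum>k<n. u k))) \<longlonglongrightarrow> 0"
  shows "coord v = (\<lambda>i. \<Sum>n. coord (u n) i)"
proof (rule coord_eqI[OF v])
  show "(\<Sum>n. coord (u n) i) = 0" if "i \<notin> I" for i
    using that by (simp add: coord_outside u)
  show "expands (\<lambda>i. \<Sum>n. coord (u n) i) v"
    unfolding expands_def
  proof (intro allI impI)
    fix \<epsilon> :: real assume \<epsilon>: "\<epsilon> > 0"
    then have e3: "\<epsilon> / 3 > 0" by simp
    have "\<forall>\<^sub>F n in sequentially. N (v - (\<Sum>k<n. u k)) < \<epsilon> / 3"
      using order_tendstoD(2)[OF lim e3] .
    moreover have "\<forall>\<^sub>F n in sequentially. (\<Sum>k. sup_proj (u (k + n))) < \<epsilon> / 3"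
      using order_tendstoD(2)[OF suminf_exist_split2[OF s] e3] .
    ultimately have "\<forall>\<^sub>F n in sequentially. N (v - (\<Sum>k<n. u k)) < \<epsilon> / 3 \<and> (\<Sum>k. sup_proj (u (k + n))) < \<epsilon> / 3"
      by (rule eventually_conj)
    then obtain n where n: "N (v - (\<Sum>k<n. u k)) < \<epsilon> / 3" "(\<Sum>k. sup_proj (u (k + n))) < \<epsilon> / 3"
      by (auto dest: eventually_happens'[OF sequentially_bot])
    \<comment> \<open>The first \<open>n\<close> projection errors together must stay below a third
      of \<epsilon>; the divisor \<open>n + 1\<close> also covers \<open>n = 0\<close>.\<close>
    have "\<exists>F0. finite F0 \<and> F0 \<subseteq> I \<and> (\<forall>F. finite F \<and> F0 \<subseteq> F \<and> F \<subseteq> I \<longrightarrow> N (u k - proj F (u k)) < \<epsilon> / (3 * (n + 1)))" for k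
    proof -
      have "\<epsilon> / (3 * (n + 1)) > 0" using \<epsilon> by simp
      from proj_approx[OF u this] show ?thesis by metis
    qed
    then obtain G where G: "\<And>k. finite (G k)" "\<And>k. G k \<subseteq> I"
      "\<And>k F. finite F \<Longrightarrow> G k \<subseteq> F \<Longrightarrow> F \<subseteq> I \<Longrightarrow> N (u k - proj F (u k)) < \<epsilon> / (3 * (n + 1))"
      by metis
    have "N (v - (\<Sum>i\<in>F. (\<Sum>n. coord (u n) i) *c x i)) < \<epsilon>"
      if F: "finite F" "(\<Union>k<n. G k) \<subseteq> F" "F \<subseteq> I" for F
    proof -
      have split: "(\<Sum>i\<in>F. (\<Sum>n. coord (u n) i) *c x i) =
          (\<Sum>k<n. proj F (u k)) + (\<Sum>i\<in>F. (\<Sum>k. coord (u (k + n)) i) *c x i)"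
      proof -
        have "(\<Sum>m. coord (u m) i) = (\<Sum>k. coord (u (k + n)) i) + (\<Sum>k<n. coord (u k) i)" if "i \<in> F" for i
          by (rule suminf_split_initial_segment, rule summable_comparison_test'[OF summable_divide[OF s, of "N (x i)"]])
             (use u F that cmod_coord_le in auto)
        then have "(\<Sum>i\<in>F. (\<Sum>n. coord (u n) i) *c x i) =
          (\<Sum>i\<in>F. (\<Sum>k. coord (u (k + n)) i) *c x i) + (\<Sum>i\<in>F. (\<Sum>k<n. coord (u k) i) *c x i)"
          by (simp add: scale_left_distrib sum.distrib)
        also have "(\<Sum>i\<in>F. (\<Sum>k<n. coord (u k) i) *c x i) = (\<Sum>k<n. proj F (u k))"
          unfolding proj_def scale_sum_left by (rule sum.swap)
        finally show ?thesis by simp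
      qed
      let ?R = "\<Sum>i\<in>F. (\<Sum>k. coord (u (k + n)) i) *c x i"
      have eq: "v - (\<Sum>i\<in>F. (\<Sum>n. coord (u n) i) *c x i) =
          (v - (\<Sum>k<n. u k)) + ((\<Sum>k<n. u k - proj F (u k)) - ?R)"
        unfolding split by (simp add: sum_subtractf)
      have "N (v - (\<Sum>i\<in>F. (\<Sum>n. coord (u n) i) *c x i)) \<le>
          N (v - (\<Sum>k<n. u k)) + (N (\<Sum>k<n. u k - proj F (u k)) + N ?R)"
        unfolding eq using F u v
        by (intro order_trans[OF N_triangle] add_left_mono N_diff_le V_intros proj_in_V sum_in_V) auto
      also have "N (\<Sum>k<n. u k - proj F (u k)) \<le> (\<Sum>k<n. N (u k - proj F (u k)))"
        using F u by (intro N_sum V_intros proj_in_V) auto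
      also have "\<dots> \<le> (\<Sum>k<n. \<epsilon> / (3 * (n + 1)))"
      proof (rule sum_mono, rule less_imp_le, rule G(3)[OF F(1) _ F(3)])
        show "G k \<subseteq> F" if "k \<in> {..<n}" for k using F(2) that by blast
      qed
      also have "\<dots> \<le> \<epsilon> / 3"
        using \<epsilon> by (simp add: field_simps)
      also have "N ?R \<le> (\<Sum>k. sup_proj (u (k + n)))"
        using s F by (intro N_proj_sum_le u) (auto simp: summable_iff_shift[of "\<lambda>k. sup_proj (u k)"])
      finally show ?thesis using n by simp
    qed
    then show "\<exists>F0. finite F0 \<and> F0 \<subseteq> I \<and> (\<forall>F. finite F \<and> F0 \<subseteq> F \<and> F \<subseteq> I \<longrightarrow>
        N (v - (\<Sum>i\<in>F. (\<Sum>n. coord (u n) i) *c x i)) < \<epsilon>)"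
      using G(1,2) by (intro exI[of _ "\<Union>k<n. G k"] conjI allI impI) auto
  qed
qed

text \<open>By \<open>coord_series\<close>, \<open>sup_proj\<close> is countably subadditive, so
  Zabreiko's lemma bounds it by the seminorm. A finite combination has the expected coefficients,
  hence its part over \<open>D\<close> is one of the projections under the supremum.\<close>

lemma suppression_constant:
  "\<exists>K\<ge>0. \<forall>F D a. finite F \<and> F \<subseteq> I \<and> D \<subseteq> F \<longrightarrow>
     N (\<Sum>i\<in>D. a i *c x i) \<le> K * N (\<Sum>i\<in>F. a i *c x i)"
proof -
  have subadd: "sup_proj v \<le> (\<Sum>n. sup_proj (u n))"
    if "\<And>n. u n \<in> V" "v \<in> V" "summable (\<lambda>n::nat. sup_proj (u n))"
      "(\<lambda>n. N (v - (\<Sum>k<n. u k))) \<longlonglongrightarrow> 0" for u v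
    by (rule sup_proj_leI) (simp add: proj_def coord_series[OF that] N_proj_sum_le that)
  have "\<exists>K\<ge>0. \<forall>v\<in>V. sup_proj v \<le> K * N v"
    by (rule zabreiko[OF sup_proj_nonneg sup_proj_scale subadd])
  then obtain K where K: "K \<ge> 0" "\<And>v. v \<in> V \<Longrightarrow> sup_proj v \<le> K * N v" by blast
  have "N (\<Sum>i\<in>D. a i *c x i) \<le> K * N (\<Sum>i\<in>F. a i *c x i)"
    if F: "finite F" "F \<subseteq> I" "D \<subseteq> F" for F D a
  proof -
    have "(\<Sum>i\<in>D. a i *c x i) = proj D (\<Sum>i\<in>F. a i *c x i)"
      unfolding proj_def using F by (intro sum.cong) (auto simp: coord_finite_sum)
    also have "N \<dots> \<le> sup_proj (\<Sum>i\<in>F. a i *c x i)"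
      using F by (intro N_proj_le sum_in_V) (auto intro: finite_subset)
    also have "\<dots> \<le> K * N (\<Sum>i\<in>F. a i *c x i)"
      using F by (intro K sum_in_V) auto
    finally show ?thesis .
  qed
  with K(1) show ?thesis by blast
qed

end

section \<open>Completeness of the Lebesgue spaces\<close>

lemma Lp_norm_nonneg: "0 \<le> Lp_norm p f"
  by (simp add: Lp_norm_def)

lemma memLp_measurable [measurable_dest]: "memLp p f \<Longrightarrow> f \<in> borel_measurable lborel"
  by (simp add: memLp_def)

lemma Lp_integral_eq:
  assumes "memLp p f" "0 < p"
  shows "Lp_integral p f = ennreal (Lp_norm p f powr p)"
  using assms by (simp add: memLp_def Lp_norm_def powr_powr)

text \<open>\<open>enn2real\<close> sends infinity to 0, so a bound on \<open>Lp_norm\<close> does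
  not imply membership. A bound on the extended integral yields both.\<close>

lemma Lp_norm_leI:
  assumes p: "0 < p" and f: "f \<in> borel_measurable lborel" and C: "0 \<le> C"
    and le: "Lp_integral p f \<le> ennreal (C powr p)"
  shows "memLp p f" "Lp_norm p f \<le> C"
proof -
  show "memLp p f"
    using f le by (auto simp: memLp_def intro: le_less_trans)
  have "enn2real (Lp_integral p f) \<le> C powr p"
    using enn2real_mono[OF le] by simp
  then have "Lp_norm p f \<le> (C powr p) powr (1 / p)"
    unfolding Lp_norm_def using p by (intro powr_mono2) auto
  then show "Lp_norm p f \<le> C"
    using p C by (simp add: powr_powr)
qed

lemma Lp_integral_scale:
  assumes "f \<in> borel_measurable lborel" "0 < p"
  shows "Lp_integral p (\<lambda>x. c * f x) = ennreal (cmod c powr p) * Lp_integral p f"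
  unfolding Lp_integral_def using assms
  by (subst nn_integral_cmult[symmetric]) (auto simp: norm_mult powr_mult ennreal_mult)

lemma
  assumes f: "memLp p f" and p: "0 < p"
  shows memLp_scale: "memLp p (\<lambda>x. c * f x)"
    and Lp_norm_scale: "Lp_norm p (\<lambda>x. c * f x) = cmod c * Lp_norm p f"
proof -
  have eq: "Lp_integral p (\<lambda>x. c * f x) = ennreal ((cmod c * Lp_norm p f) powr p)"
    using f p by (simp add: Lp_integral_scale[OF memLp_measurable[OF f]] Lp_integral_eq powr_mult
        Lp_norm_nonneg ennreal_mult)
  show "memLp p (\<lambda>x. c * f x)"
    using memLp_measurable[OF f] eq by (simp add: memLp_def)
  show "Lp_norm p (\<lambda>x. c * f x) = cmod c * Lp_norm p f"
    unfolding Lp_norm_def[of p "\<lambda>x. c * f x"] eq using p by (simp add: powr_powr Lp_norm_nonneg)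
qed

text \<open>For positive \<open>u\<close> and \<open>v\<close> this is convexity. If one of them is
  0, it reduces to \<open>t powr p \<le> t\<close> on the unit interval, with a weight for
  \<open>t\<close>.\<close>

lemma powr_convex_combination:
  fixes u v \<theta> p :: real
  assumes p: "1 \<le> p" and uv: "0 \<le> u" "0 \<le> v" and \<theta>: "0 \<le> \<theta>" "\<theta> \<le> 1"
  shows "(\<theta> * u + (1 - \<theta>) * v) powr p \<le> \<theta> * u powr p + (1 - \<theta>) * v powr p"
proof -
  have small: "t powr p \<le> t" if "0 \<le> t" "t \<le> 1" for t :: real
    using that powr_mono'[OF p, of t] by simp
  show ?thesis
  proof (cases "u = 0 \<or> v = 0")
    case True
    then show ?thesis
      using \<theta> uv small[of \<theta>] small[of "1 - \<theta>"] p by (auto simp: powr_mult intro!: mult_right_mono)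
  next
    case False
    with uv have "u > 0" "v > 0" by auto
    with convex_onD[OF powr_convex[OF p], of "1 - \<theta>" u v] \<theta> show ?thesis by simp
  qed
qed

text \<open>Convexity is applied to the moduli of \<open>f\<close> and \<open>g\<close> divided by
  \<open>A\<close> and \<open>B\<close>, with weights \<open>A / (A + B)\<close> and
  \<open>B / (A + B)\<close>. Since \<open>A\<close> and \<open>B\<close> lie strictly above the
  norms, both are positive even if a norm vanishes; at the end they are lowered to the
  norms.\<close>

lemma minkowski:
  assumes p: "1 \<le> p" and f: "memLp p f" and g: "memLp p g"
  shows memLp_add: "memLp p (\<lambda>x. f x + g x)"
    and Lp_norm_triangle: "Lp_norm p (\<lambda>x. f x + g x) \<le> Lp_norm p f + Lp_norm p g"
proof -
  have [measurable]: "f \<in> borel_measurable lborel" "g \<in> borel_measurable lborel"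
    using f g by (auto dest: memLp_measurable)
  have *: "memLp p (\<lambda>x. f x + g x) \<and> Lp_norm p (\<lambda>x. f x + g x) \<le> A + B"
    if A: "Lp_norm p f < A" and B: "Lp_norm p g < B" for A B
  proof -
    have AB: "A > 0" "B > 0" using A B Lp_norm_nonneg[of p f] Lp_norm_nonneg[of p g] by linarith+
    define \<theta> where "\<theta> = A / (A + B)"
    have \<theta>: "0 \<le> \<theta>" "\<theta> \<le> 1" "1 - \<theta> = B / (A + B)" using AB by (auto simp: \<theta>_def field_simps)
    define \<alpha> where "\<alpha> = (A + B) powr p * (\<theta> / A powr p)"
    define \<beta> where "\<beta> = (A + B) powr p * ((1 - \<theta>) / B powr p)"
    have nn: "\<alpha> \<ge> 0" "\<beta> \<ge> 0" using AB \<theta> by (auto simp: \<alpha>_def \<beta>_def)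
    have pw: "cmod (f x + g x) powr p \<le> \<alpha> * cmod (f x) powr p + \<beta> * cmod (g x) powr p" for x
    proof -
      have "cmod (f x + g x) powr p \<le> (cmod (f x) + cmod (g x)) powr p"
        using p by (intro powr_mono2 norm_triangle_ineq) auto
      also have "cmod (f x) + cmod (g x) = ((A + B) * \<theta>) * (cmod (f x) / A) + ((A + B) * (1 - \<theta>)) * (cmod (g x) / B)"
        using AB unfolding \<theta>(3) unfolding \<theta>_def by simp
      also have "\<dots> = (A + B) * (\<theta> * (cmod (f x) / A) + (1 - \<theta>) * (cmod (g x) / B))"
        by (simp only: distrib_left mult.assoc)
      also have "\<dots> powr p = (A + B) powr p * (\<theta> * (cmod (f x) / A) + (1 - \<theta>) * (cmod (g x) / B)) powr p"
        by (rule powr_mult)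
      also have "\<dots> \<le> (A + B) powr p * (\<theta> * (cmod (f x) / A) powr p + (1 - \<theta>) * (cmod (g x) / B) powr p)"
        using AB \<theta> by (intro mult_left_mono powr_convex_combination p) auto
      also have "\<dots> = \<alpha> * cmod (f x) powr p + \<beta> * cmod (g x) powr p"
        using AB by (simp add: \<alpha>_def \<beta>_def powr_divide field_simps)
      finally show ?thesis .
    qed
    have "Lp_integral p (\<lambda>x. f x + g x) \<le>
        (\<integral>\<^sup>+ x. ennreal \<alpha> * ennreal (cmod (f x) powr p) + ennreal \<beta> * ennreal (cmod (g x) powr p) \<partial>lborel)"
      unfolding Lp_integral_def
      using pw nn by (intro nn_integral_mono) (simp flip: ennreal_mult ennreal_plus)
    also have "\<dots> = ennreal \<alpha> * Lp_integral p f + ennreal \<beta> * Lp_integral p g"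
      unfolding Lp_integral_def by (simp add: nn_integral_add nn_integral_cmult)
    also have "\<dots> \<le> ennreal \<alpha> * ennreal (A powr p) + ennreal \<beta> * ennreal (B powr p)"
      using p A B f g Lp_norm_nonneg
      by (intro add_mono mult_left_mono) (auto simp: Lp_integral_eq intro!: powr_mono2 ennreal_leI)
    also have "\<dots> = ennreal (\<alpha> * A powr p + \<beta> * B powr p)"
      using nn by (simp add: ennreal_mult)
    also have "\<alpha> * A powr p + \<beta> * B powr p = (A + B) powr p"
      using AB by (simp add: \<alpha>_def \<beta>_def) (simp add: algebra_simps)
    finally have "Lp_integral p (\<lambda>x. f x + g x) \<le> ennreal ((A + B) powr p)" .
    with Lp_norm_leI[of p "\<lambda>x. f x + g x" "A + B"] p AB show ?thesis by simp
  qed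
  from *[of "Lp_norm p f + 1" "Lp_norm p g + 1"] show "memLp p (\<lambda>x. f x + g x)" by simp
  show "Lp_norm p (\<lambda>x. f x + g x) \<le> Lp_norm p f + Lp_norm p g"
  proof (rule field_le_epsilon)
    fix e :: real assume "e > 0"
    with *[of "Lp_norm p f + e / 2" "Lp_norm p g + e / 2"]
    show "Lp_norm p (\<lambda>x. f x + g x) \<le> Lp_norm p f + Lp_norm p g + e" by (simp add: add_ac)
  qed
qed

lemma memLp_zero: "memLp p (\<lambda>x. 0)"
  by (simp add: memLp_def Lp_integral_def)

lemma minkowski_sum:
  assumes p: "1 \<le> p" and f: "\<And>i. i \<in> F \<Longrightarrow> memLp p (f i)"
  shows "memLp p (\<lambda>x. \<Sum>i\<in>F. f i x)"
    and "Lp_norm p (\<lambda>x. \<Sum>i\<in>F. f i x) \<le> (\<Sum>i\<in>F. Lp_norm p (f i))"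
proof -
  have "memLp p (\<lambda>x. \<Sum>i\<in>F. f i x) \<and> Lp_norm p (\<lambda>x. \<Sum>i\<in>F. f i x) \<le> (\<Sum>i\<in>F. Lp_norm p (f i))"
    using f
  proof (induction F rule: infinite_finite_induct)
    case (insert i F)
    then show ?case
      using minkowski[OF p, of "f i" "\<lambda>x. \<Sum>i\<in>F. f i x"] by force
  qed (use p in \<open>auto simp: memLp_zero Lp_norm_def Lp_integral_def\<close>)
  then show "memLp p (\<lambda>x. \<Sum>i\<in>F. f i x)"
    "Lp_norm p (\<lambda>x. \<Sum>i\<in>F. f i x) \<le> (\<Sum>i\<in>F. Lp_norm p (f i))" by auto
qed

lemma Lp_fatou:
  assumes p: "0 < p" and t: "\<And>m::nat. memLp p (t m)" and le: "\<And>m. Lp_norm p (t m) \<le> C"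
    and w: "w \<in> borel_measurable lborel" and lim: "AE x in lborel. (\<lambda>m. t m x) \<longlonglongrightarrow> w x"
  shows "memLp p w" "Lp_norm p w \<le> C"
proof -
  have [measurable]: "t m \<in> borel_measurable lborel" for m
    using t by (rule memLp_measurable)
  have C: "C \<ge> 0" using le[of 0] Lp_norm_nonneg order_trans by blast
  have "Lp_integral p w = (\<integral>\<^sup>+ x. liminf (\<lambda>m. ennreal (cmod (t m x) powr p)) \<partial>lborel)"
    unfolding Lp_integral_def
  proof (rule nn_integral_cong_AE)
    show "AE x in lborel. ennreal (cmod (w x) powr p) = liminf (\<lambda>m. ennreal (cmod (t m x) powr p))"
      using lim
    proof eventually_elim
      case (elim x)
      then have "(\<lambda>m. ennreal (cmod (t m x) powr p)) \<longlonglongrightarrow> ennreal (cmod (w x) powr p)"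
        using p by (intro tendsto_ennrealI tendsto_powr2 tendsto_norm tendsto_const) auto
      then show ?case by (rule lim_imp_Liminf[OF sequentially_bot, symmetric])
    qed
  qed
  also have "\<dots> \<le> liminf (\<lambda>m. Lp_integral p (t m))"
    unfolding Lp_integral_def by (rule nn_integral_liminf) simp
  also have "\<dots> \<le> liminf (\<lambda>m. ennreal (C powr p))"
    using p C le t by (intro Liminf_mono always_eventually)
      (auto simp: Lp_integral_eq Lp_norm_nonneg intro!: ennreal_leI powr_mono2)
  also have "\<dots> = ennreal (C powr p)" by (simp add: Liminf_const)
  finally have "Lp_integral p w \<le> ennreal (C powr p)" .
  with p C w show "memLp p w" "Lp_norm p w \<le> C" by (auto intro: Lp_norm_leI)
qed

text \<open>Minkowski's inequality bounds the partial sums of the moduli uniformly in norm. By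
  monotone convergence the \<open>p\<close>-th power of their supremum is integrable, hence finite
  almost everywhere.\<close>

lemma AE_summable_Lp:
  assumes p: "1 \<le> p" and u: "\<And>n::nat. memLp p (u n)" and s: "summable (\<lambda>n. Lp_norm p (u n))"
  shows "AE x in lborel. summable (\<lambda>n. u n x)"
proof -
  have [measurable]: "u n \<in> borel_measurable lborel" for n
    using u by (rule memLp_measurable)
  define h where "h m x = (\<Sum>k<m. cmod (u k x))" for m x
  have h_nonneg: "0 \<le> h m x" for m x by (auto simp: h_def intro: sum_nonneg)
  have abs: "memLp p (\<lambda>x. complex_of_real (cmod (u k x)))"
    "Lp_norm p (\<lambda>x. complex_of_real (cmod (u k x))) = Lp_norm p (u k)" for k
    using u[of k] by (auto simp: memLp_def Lp_norm_def Lp_integral_def)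
  define S where "S = (\<Sum>n. Lp_norm p (u n))"
  have int: "(\<integral>\<^sup>+ x. ennreal (h m x powr p) \<partial>lborel) \<le> ennreal (S powr p)" for m
  proof -
    note M = minkowski_sum[OF p, of "{..<m}" "\<lambda>k x. complex_of_real (cmod (u k x))", OF abs(1)]
    have "Lp_norm p (\<lambda>x. complex_of_real (h m x)) \<le> S"
      using M(2) sum_le_suminf[OF s, of "{..<m}"] Lp_norm_nonneg by (auto simp: abs h_def S_def)
    moreover have "(\<integral>\<^sup>+ x. ennreal (h m x powr p) \<partial>lborel) = Lp_integral p (\<lambda>x. complex_of_real (h m x))"
      by (simp add: Lp_integral_def h_nonneg)
    moreover have "memLp p (\<lambda>x. complex_of_real (h m x))" using M(1) by (simp add: h_def)
    ultimately show ?thesis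
      using p by (auto simp: Lp_integral_eq Lp_norm_nonneg intro!: ennreal_leI powr_mono2)
  qed
  have inc: "incseq (\<lambda>m x. ennreal (h m x powr p))"
    using p by (intro incseq_SucI le_funI ennreal_leI powr_mono2) (auto simp: h_def intro: sum_nonneg)
  have "(\<integral>\<^sup>+ x. (SUP m. ennreal (h m x powr p)) \<partial>lborel) = (SUP m. \<integral>\<^sup>+ x. ennreal (h m x powr p) \<partial>lborel)"
    by (rule nn_integral_monotone_convergence_SUP[OF inc]) (simp add: h_def)
  also have "\<dots> \<le> ennreal (S powr p)" by (intro SUP_least int)
  finally have "(\<integral>\<^sup>+ x. (SUP m. ennreal (h m x powr p)) \<partial>lborel) \<noteq> \<infinity>"
    by (auto simp: top_unique)
  then have "AE x in lborel. (SUP m. ennreal (h m x powr p)) \<noteq> \<infinity>"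
    by (intro nn_integral_PInf_AE) (auto simp: h_def)
  then show ?thesis
  proof eventually_elim
    case (elim x)
    then obtain B where B: "B \<ge> 0" "(SUP m. ennreal (h m x powr p)) = ennreal B"
      by (metis enn2real_nonneg ennreal_enn2real_if infinity_ennreal_def)
    have "h m x \<le> B powr (1 / p)" for m
    proof -
      have "ennreal (h m x powr p) \<le> ennreal B" unfolding B(2)[symmetric] by (rule SUP_upper) simp
      then have "h m x powr p \<le> B" using B(1) by simp
      then have "(h m x powr p) powr (1 / p) \<le> B powr (1 / p)" using p by (intro powr_mono2) auto
      then show ?thesis using p h_nonneg by (simp add: powr_powr)
    qed
    then have "summable (\<lambda>k. cmod (u k x))"
      by (intro summableI_nonneg_bounded) (auto simp: h_def)
    then show ?case by (rule summable_norm_cancel)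
  qed
qed

lemma riesz_fischer:
  assumes p: "1 \<le> p" and u: "\<And>n::nat. memLp p (u n)" and s: "summable (\<lambda>n. Lp_norm p (u n))"
  shows "\<exists>v. memLp p v \<and> (\<lambda>n. Lp_norm p (\<lambda>x. v x - (\<Sum>k<n. u k x))) \<longlonglongrightarrow> 0"
proof -
  have [measurable]: "u n \<in> borel_measurable lborel" for n
    using u by (rule memLp_measurable)
  \<comment> \<open>Where the series diverges, \<open>lim\<close> has an unspecified value. This
    happens only on a null set, and \<open>v\<close> is measurable all the same.\<close>
  define v where "v x = lim (\<lambda>n. \<Sum>k<n. u k x)" for x
  have v [measurable]: "v \<in> borel_measurable lborel"
    unfolding v_def by (intro borel_measurable_lim_metric) simp
  have conv: "AE x in lborel. (\<lambda>n. \<Sum>k<n. u k x) \<longlonglongrightarrow> v x"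
    using AE_summable_Lp[OF p u s]
    unfolding v_def summable_iff_convergent convergent_LIMSEQ_iff .
  \<comment> \<open>Fatou's lemma is applied to the blocks of \<open>m\<close> terms after the first
    \<open>n\<close>; their norms are at most the tail of the norm series. The case
    \<open>n = 0\<close> later gives membership of \<open>v\<close> itself.\<close>
  have tail: "memLp p (\<lambda>x. v x - (\<Sum>k<n. u k x)) \<and>
      Lp_norm p (\<lambda>x. v x - (\<Sum>k<n. u k x)) \<le> (\<Sum>k. Lp_norm p (u (k + n)))" for n
  proof -
    have s': "summable (\<lambda>k. Lp_norm p (u (k + n)))"
      using s by (rule summable_ignore_initial_segment)
    have t: "memLp p (\<lambda>x. \<Sum>k<m. u (k + n) x)"
      "Lp_norm p (\<lambda>x. \<Sum>k<m. u (k + n) x) \<le> (\<Sum>k. Lp_norm p (u (k + n)))" for m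
    proof -
      show "memLp p (\<lambda>x. \<Sum>k<m. u (k + n) x)" by (intro minkowski_sum p u)
      have "Lp_norm p (\<lambda>x. \<Sum>k<m. u (k + n) x) \<le> (\<Sum>k<m. Lp_norm p (u (k + n)))"
        by (intro minkowski_sum p u)
      also have "\<dots> \<le> (\<Sum>k. Lp_norm p (u (k + n)))"
        by (intro sum_le_suminf s') (auto simp: Lp_norm_nonneg)
      finally show "Lp_norm p (\<lambda>x. \<Sum>k<m. u (k + n) x) \<le> (\<Sum>k. Lp_norm p (u (k + n)))" .
    qed
    have lim: "AE x in lborel. (\<lambda>m. \<Sum>k<m. u (k + n) x) \<longlonglongrightarrow> v x - (\<Sum>k<n. u k x)"
      using conv
    proof eventually_elim
      case (elim x)
      then have "(\<lambda>k. u k x) sums v x" by (simp add: sums_def)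
      then have "(\<lambda>k. u (k + n) x) sums (v x - (\<Sum>k<n. u k x))" by (rule sums_split_initial_segment)
      then show ?case by (simp add: sums_def)
    qed
    show ?thesis
      using Lp_fatou[OF _ t _ lim] p by simp
  qed
  have "(\<lambda>n. Lp_norm p (\<lambda>x. v x - (\<Sum>k<n. u k x))) \<longlonglongrightarrow> 0"
    using tail by (intro tendsto_sandwich[OF _ _ tendsto_const suminf_exist_split2[OF s]])
      (auto simp: Lp_norm_nonneg)
  moreover have "memLp p v" using tail[of 0] by simp
  ultimately show ?thesis by blast
qed

section \<open>Closed spans in the Lebesgue spaces as instances of the abstract setting\<close>

lemma sum_fun_apply: "(\<Sum>i\<in>F. f i) x = (\<Sum>i\<in>F. f i x)"
  by (induction F rule: infinite_finite_induct) auto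

lemma lin_comb_eq_sum: "lin_comb x F c = (\<Sum>i\<in>F. (\<lambda>y. c i * x i y))"
  by (simp add: fun_eq_iff lin_comb_def sum_fun_apply)

lemma complete_seminormed_Lp:
  assumes p: "1 \<le> p"
  shows "complete_seminormed (\<lambda>c f x. c * f x) {f. memLp p f} (Lp_norm p)"
proof -
  interpret vector_space "\<lambda>c (f :: real \<Rightarrow> complex) x. c * f x"
    by unfold_locales (auto simp: fun_eq_iff algebra_simps)
  show ?thesis
  proof unfold_locales
    show "subspace {f. memLp p f}"
      using p memLp_zero memLp_add[OF p] memLp_scale
      by (auto simp: subspace_def zero_fun_def plus_fun_def)
  next
    fix h :: "nat \<Rightarrow> real \<Rightarrow> complex"
    assume "\<And>n. h n \<in> {f. memLp p f}" "summable (\<lambda>n. Lp_norm p (h n))"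
    with riesz_fischer[OF p, of h] obtain v where
      "memLp p v" "(\<lambda>n. Lp_norm p (\<lambda>x. v x - (\<Sum>k<n. h k x))) \<longlonglongrightarrow> 0" by auto
    then show "\<exists>v\<in>{f. memLp p f}. (\<lambda>n. Lp_norm p (v - sum h {..<n})) \<longlonglongrightarrow> 0"
      by (auto simp: fun_diff_def sum_fun_apply)
  qed (use p Lp_norm_triangle[OF p] in \<open>auto simp: Lp_norm_nonneg Lp_norm_scale plus_fun_def\<close>)
qed

lemma complete_seminormed_closed_span_Lp:
  assumes p: "1 \<le> p" and x: "\<And>i. i \<in> I \<Longrightarrow> memLp p (x i)"
  shows "complete_seminormed (\<lambda>c f y. c * f y) (closed_span_Lp p x I) (Lp_norm p)"
proof -
  interpret complete_seminormed "\<lambda>c f y. c * f y" "{f. memLp p f}" "Lp_norm p"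
    by (rule complete_seminormed_Lp[OF p])
  let ?W = "{lin_comb x F c | F c. finite F \<and> F \<subseteq> I}"
  have sub: "subspace ?W"
  proof (rule subspaceI)
    show "0 \<in> ?W" by (auto simp: lin_comb_eq_sum intro!: exI[of _ "{}"])
  next
    fix f g assume "f \<in> ?W" "g \<in> ?W"
    then obtain F c G d where f: "f = lin_comb x F c" "finite F" "F \<subseteq> I"
      and g: "g = lin_comb x G d" "finite G" "G \<subseteq> I" by auto
    have "lin_comb x F c = lin_comb x (F \<union> G) (\<lambda>i. if i \<in> F then c i else 0)"
      unfolding lin_comb_def using f g by (intro ext sum.mono_neutral_cong_left) auto
    moreover have "lin_comb x G d = lin_comb x (F \<union> G) (\<lambda>i. if i \<in> G then d i else 0)"
      unfolding lin_comb_def using f g by (intro ext sum.mono_neutral_cong_left) auto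
    ultimately have "f + g = lin_comb x (F \<union> G)
        (\<lambda>i. (if i \<in> F then c i else 0) + (if i \<in> G then d i else 0))"
      unfolding f g by (simp add: lin_comb_def fun_eq_iff sum.distrib distrib_right)
    with f g show "f + g \<in> ?W" by blast
  next
    fix a f assume "f \<in> ?W"
    then obtain F c where f: "f = lin_comb x F c" "finite F" "F \<subseteq> I" by auto
    have "(\<lambda>y. a * f y) = lin_comb x F (\<lambda>i. a * c i)"
      by (simp add: f lin_comb_def sum_distrib_left mult.assoc)
    with f show "(\<lambda>y. a * f y) \<in> ?W" by blast
  qed
  have "?W \<subseteq> {f. memLp p f}"
    unfolding lin_comb_def using p x by (auto intro!: minkowski_sum memLp_scale)
  note closure = complete_seminormed_closure[OF sub this]
  have "(\<exists>w\<in>?W. P w) \<longleftrightarrow> (\<exists>F c. finite F \<and> F \<subseteq> I \<and> P (lin_comb x F c))" for P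
    by blast
  then have "{f \<in> {f. memLp p f}. \<forall>\<epsilon>>0. \<exists>w\<in>?W. Lp_norm p (f - w) < \<epsilon>} = closed_span_Lp p x I"
    unfolding closed_span_Lp_def by (simp only: mem_Collect_eq fun_diff_def)
  with closure show ?thesis by simp
qed

lemma unique_unconditional_expansions_Lp:
  assumes p: "1 \<le> p" and x: "uncond_basic_seq_Lp p x I"
  shows "unique_unconditional_expansions (\<lambda>c f y. c * f y) (closed_span_Lp p x I) (Lp_norm p) x I"
proof -
  have mem: "memLp p (x i)" if "i \<in> I" for i
    using x that by (simp add: uncond_basic_seq_Lp_def)
  have [simp]: "Lp_norm p (\<lambda>y. 0) = 0"
    using p by (simp add: Lp_norm_def Lp_integral_def)
  interpret complete_seminormed "\<lambda>c f y. c * f y" "closed_span_Lp p x I" "Lp_norm p"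
    by (rule complete_seminormed_closed_span_Lp[OF p mem])
  show ?thesis
  proof
    fix i assume i: "i \<in> I"
    have "Lp_norm p (\<lambda>y. x i y - lin_comb x {i} (\<lambda>_. 1) y) = 0" by (simp add: lin_comb_def)
    with i mem show "x i \<in> closed_span_Lp p x I"
      unfolding closed_span_Lp_def by (intro CollectI conjI allI impI exI[of _ "{i}"] exI[of _ "\<lambda>_. 1"]) simp_all
  next
    fix f assume "f \<in> closed_span_Lp p x I"
    with x have "\<exists>!c. (\<forall>i. i \<notin> I \<longrightarrow> c i = 0) \<and> uncond_converges_Lp p x I c f"
      unfolding uncond_basic_seq_Lp_def by blast
    then show "\<exists>!c. (\<forall>i. i \<notin> I \<longrightarrow> c i = 0) \<and>
      (\<forall>\<epsilon>>0. \<exists>F0. finite F0 \<and> F0 \<subseteq> I \<and>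
        (\<forall>F. finite F \<and> F0 \<subseteq> F \<and> F \<subseteq> I \<longrightarrow>
          Lp_norm p (f - (\<Sum>i\<in>F. (\<lambda>y. c i * x i y))) < \<epsilon>))"
      unfolding uncond_converges_Lp_def lin_comb_eq_sum fun_diff_def .
  qed
qed


section \<open>Random signs\<close>

text \<open>A Rademacher sum: \<open>D\<close> collects the indices with negative sign, so summing
  over \<open>Pow F\<close> and dividing by \<open>2 ^ card F\<close> is the expectation over
  independent signs.\<close>

definition signed_sum :: "('i \<Rightarrow> complex) \<Rightarrow> 'i set \<Rightarrow> 'i set \<Rightarrow> complex" where
  "signed_sum z F D = (\<Sum>i\<in>F. if i \<in> D then - z i else z i)"

lemma signed_sum_insert:
  assumes "finite F" "i \<notin> F" "D \<subseteq> F"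
  shows "signed_sum z (insert i F) D = signed_sum z F D + z i"
    and "signed_sum z (insert i F) (insert i D) = signed_sum z F D - z i"
proof -
  show "signed_sum z (insert i F) D = signed_sum z F D + z i"
    using assms by (auto simp: signed_sum_def)
  have "(\<Sum>j\<in>F. if j \<in> insert i D then - z j else z j) = signed_sum z F D"
    unfolding signed_sum_def using assms by (intro sum.cong) auto
  then show "signed_sum z (insert i F) (insert i D) = signed_sum z F D - z i"
    unfolding signed_sum_def[of z "insert i F"] using assms by simp
qed

text \<open>Conditioning on the sign of \<open>i\<close>: the subsets come in pairs \<open>D\<close>
  and \<open>insert i D\<close>.\<close>

lemma sum_Pow_insert:
  assumes "finite F" "i \<notin> F"
  shows "(\<Sum>D\<in>Pow (insert i F). h D) = (\<Sum>D\<in>Pow F. h D + h (insert i D))"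
proof -
  have inj: "inj_on (insert i) (Pow F)"
    using assms by (auto simp: inj_on_def)
  have "(\<Sum>D\<in>Pow (insert i F). h D) = (\<Sum>D\<in>Pow F. h D) + (\<Sum>D\<in>insert i ` Pow F. h D)"
    unfolding Pow_insert using assms by (intro sum.union_disjoint) auto
  also have "(\<Sum>D\<in>insert i ` Pow F. h D) = (\<Sum>D\<in>Pow F. h (insert i D))"
    by (simp add: sum.reindex[OF inj])
  finally show ?thesis by (simp add: sum.distrib)
qed

text \<open>On each such pair the parallelogram law removes the cross terms.\<close>

lemma signed_sum_second_moment:
  assumes "finite F"
  shows "(\<Sum>D\<in>Pow F. (cmod (signed_sum z F D))\<^sup>2) = 2 ^ card F * (\<Sum>i\<in>F. (cmod (z i))\<^sup>2)"
  using assms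
proof (induction F)
  case empty
  then show ?case by (simp add: signed_sum_def)
next
  case (insert i F)
  have "(\<Sum>D\<in>Pow (insert i F). (cmod (signed_sum z (insert i F) D))\<^sup>2) =
      (\<Sum>D\<in>Pow F. 2 * (cmod (signed_sum z F D))\<^sup>2 + 2 * (cmod (z i))\<^sup>2)"
    unfolding sum_Pow_insert[OF insert(1,2)]
  proof (rule sum.cong)
    fix D assume "D \<in> Pow F"
    then show "(cmod (signed_sum z (insert i F) D))\<^sup>2 + (cmod (signed_sum z (insert i F) (insert i D)))\<^sup>2 =
        2 * (cmod (signed_sum z F D))\<^sup>2 + 2 * (cmod (z i))\<^sup>2"
      using insert(1,2) by (simp add: signed_sum_insert cmod_power2) (simp add: power2_eq_square algebra_simps)
  qed simp
  also have "\<dots> = 2 * (\<Sum>D\<in>Pow F. (cmod (signed_sum z F D))\<^sup>2) + 2 * 2 ^ card F * (cmod (z i))\<^sup>2"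
    using insert(1) by (simp add: sum.distrib card_Pow flip: sum_distrib_left)
  finally show ?case using insert by (simp add: algebra_simps)
qed

text \<open>With a and b the squared moduli and r the real inner product of \<open>u\<close> and
  \<open>v\<close>, the left-hand side is 2(a + b)^2 + 8r^2. The bound r^2 \<le> ab is
  Cauchy-Schwarz, read off from Lagrange's identity.\<close>

lemma fourth_power_parallelogram_le:
  fixes u v :: complex
  shows "cmod (u + v) ^ 4 + cmod (u - v) ^ 4 \<le> 2 * cmod u ^ 4 + 12 * (cmod u)\<^sup>2 * (cmod v)\<^sup>2 + 2 * cmod v ^ 4"
proof -
  let ?a = "(cmod u)\<^sup>2" and ?b = "(cmod v)\<^sup>2" and ?r = "Re u * Re v + Im u * Im v"
  have p: "cmod (u + v) ^ 4 = (?a + ?b + 2 * ?r)\<^sup>2"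
  proof -
    have "cmod (u + v) ^ 4 = ((cmod (u + v))\<^sup>2)\<^sup>2" by (simp flip: power_mult)
    also have "(cmod (u + v))\<^sup>2 = ?a + ?b + 2 * ?r"
      by (simp add: cmod_power2) (simp add: power2_eq_square algebra_simps)
    finally show ?thesis .
  qed
  have m: "cmod (u - v) ^ 4 = (?a + ?b - 2 * ?r)\<^sup>2"
  proof -
    have "cmod (u - v) ^ 4 = ((cmod (u - v))\<^sup>2)\<^sup>2" by (simp flip: power_mult)
    also have "(cmod (u - v))\<^sup>2 = ?a + ?b - 2 * ?r"
      by (simp add: cmod_power2) (simp add: power2_eq_square algebra_simps)
    finally show ?thesis .
  qed
  have r: "?r\<^sup>2 \<le> ?a * ?b"
  proof -
    have "?a * ?b - ?r\<^sup>2 = (Re u * Im v - Im u * Re v)\<^sup>2"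
      by (simp add: cmod_power2) (simp add: power2_eq_square algebra_simps)
    moreover have "0 \<le> (Re u * Im v - Im u * Re v)\<^sup>2" by simp
    ultimately show ?thesis by linarith
  qed
  have a: "cmod u ^ 4 = ?a\<^sup>2" and b: "cmod v ^ 4 = ?b\<^sup>2" by (simp_all flip: power_mult)
  have "(x + y + 2 * t)\<^sup>2 + (x + y - 2 * t)\<^sup>2 \<le> 2 * x\<^sup>2 + 12 * x * y + 2 * y\<^sup>2" if "t\<^sup>2 \<le> x * y" for x y t :: real
  proof -
    have "(x + y + 2 * t)\<^sup>2 + (x + y - 2 * t)\<^sup>2 = 2 * x\<^sup>2 + 4 * (x * y) + 2 * y\<^sup>2 + 8 * t\<^sup>2"
      by (simp add: power2_eq_square algebra_simps)
    with that show ?thesis by simp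
  qed
  from this[OF r] show ?thesis unfolding p m a b .
qed

text \<open>In the induction step the mixed term \<open>?n * ?s * ?b\<close> arises with factor 12,
  while a constant K in the claim provides 4K of it. So 3 is the least constant that this induction
  supports, and the pure squares leave a surplus.\<close>

lemma signed_sum_fourth_moment:
  assumes "finite F"
  shows "(\<Sum>D\<in>Pow F. cmod (signed_sum z F D) ^ 4) \<le> 3 * 2 ^ card F * (\<Sum>i\<in>F. (cmod (z i))\<^sup>2)\<^sup>2"
  using assms
proof (induction F)
  case empty
  then show ?case by (simp add: signed_sum_def)
next
  case (insert i F)
  let ?s = "\<Sum>i\<in>F. (cmod (z i))\<^sup>2" and ?b = "(cmod (z i))\<^sup>2" and ?n = "2 ^ card F :: real"
  have b: "cmod (z i) ^ 4 = ?b\<^sup>2" by (simp flip: power_mult)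
  have "(\<Sum>D\<in>Pow (insert i F). cmod (signed_sum z (insert i F) D) ^ 4) \<le>
      (\<Sum>D\<in>Pow F. 2 * cmod (signed_sum z F D) ^ 4 + 12 * (cmod (signed_sum z F D))\<^sup>2 * ?b + 2 * ?b\<^sup>2)"
    unfolding sum_Pow_insert[OF insert(1,2)]
  proof (rule sum_mono)
    fix D assume "D \<in> Pow F"
    then show "cmod (signed_sum z (insert i F) D) ^ 4 + cmod (signed_sum z (insert i F) (insert i D)) ^ 4 \<le>
        2 * cmod (signed_sum z F D) ^ 4 + 12 * (cmod (signed_sum z F D))\<^sup>2 * ?b + 2 * ?b\<^sup>2"
      using fourth_power_parallelogram_le[of "signed_sum z F D" "z i"] insert(1,2)
      unfolding b by (simp add: signed_sum_insert)
  qed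
  also have "\<dots> = 2 * (\<Sum>D\<in>Pow F. cmod (signed_sum z F D) ^ 4) +
      12 * (\<Sum>D\<in>Pow F. (cmod (signed_sum z F D))\<^sup>2) * ?b + 2 * ?n * ?b\<^sup>2"
    unfolding sum.distrib sum_distrib_left[symmetric] sum_distrib_right[symmetric]
    using insert(1) by (simp add: card_Pow)
  also have "\<dots> \<le> 2 * (3 * ?n * ?s\<^sup>2) + 12 * (?n * ?s) * ?b + 2 * ?n * ?b\<^sup>2"
    using insert.IH by (simp add: signed_sum_second_moment[OF insert(1)])
  also have "\<dots> = 3 * (2 * ?n) * (?b + ?s)\<^sup>2 - 4 * ?n * ?b\<^sup>2"
    unfolding power2_sum by (simp only: algebra_simps)
  also have "\<dots> \<le> 3 * (2 * ?n) * (?b + ?s)\<^sup>2" by simp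
  finally show ?case using insert(1,2) by simp
qed

text \<open>After normalisation, Khinchine's inequality is the average over the signs of the elementary
  bounds \<open>y\<^sup>2 - y\<^sup>4 / 4 \<le> y powr p \<le> 1 + y\<^sup>2\<close>; the sets \<open>D \<subseteq> F\<close> index the signs.\<close>

lemma powr_le_one_plus_square:
  fixes y :: real assumes "0 \<le> y" "0 \<le> p" "p \<le> 2" shows "y powr p \<le> 1 + y\<^sup>2"
proof (cases "y \<le> 1")
  case True
  then have "y powr p \<le> 1" using assms by (simp add: powr_le1)
  then show ?thesis by (simp add: add_increasing2)
next
  case False
  then have "y powr p \<le> y powr 2" using assms by (intro powr_mono) auto
  with False show ?thesis by (simp add: powr_numeral)
qed

lemma square_minus_fourth_le_powr:
  fixes y :: real assumes "0 \<le> y" "0 \<le> p" "p \<le> 2" shows "y\<^sup>2 - y ^ 4 / 4 \<le> y powr p"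
proof (cases "y \<le> 1")
  case True
  have "y\<^sup>2 \<le> y powr p"
  proof (cases "y = 0")
    case False
    with True assms have "y powr 2 \<le> y powr p" by (intro powr_mono') auto
    with False assms show ?thesis by (simp add: powr_numeral)
  qed simp
  moreover have "0 \<le> y ^ 4" using assms by simp
  ultimately show ?thesis by linarith
next
  case False
  then have "1 \<le> y powr p" using assms by (simp add: ge_one_powr_ge_zero)
  \<comment> \<open>In the variable t = y^2, the function t - t^2/4 attains its maximum 1 at t = 2;
    this is the corresponding completed square.\<close>
  moreover have "0 \<le> (y\<^sup>2 / 2 - 1)\<^sup>2" by simp
  then have "y\<^sup>2 - y ^ 4 / 4 \<le> 1"
    by (simp add: power2_eq_square power4_eq_xxxx field_simps)
  ultimately show ?thesis by linarith
qed

lemma khinchine: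
  assumes F: "finite F" and p: "0 \<le> p" "p \<le> 2"
  shows khinchine_upper: "(\<Sum>D\<in>Pow F. cmod (signed_sum z F D) powr p) \<le>
      2 * 2 ^ card F * (\<Sum>i\<in>F. (cmod (z i))\<^sup>2) powr (p / 2)"
    and khinchine_lower: "5 / 16 * 2 ^ card F * (\<Sum>i\<in>F. (cmod (z i))\<^sup>2) powr (p / 2) \<le>
      (\<Sum>D\<in>Pow F. cmod (signed_sum z F D) powr p)"
proof -
  let ?n = "2 ^ card F :: real"
  define S where "S = (\<Sum>i\<in>F. (cmod (z i))\<^sup>2)"
  have S0: "S \<ge> 0" by (auto simp: S_def intro: sum_nonneg)
  have scaled: "cmod w powr p = s powr p * (cmod w / s) powr p" if "s > 0" for s w
    using that by (simp add: powr_divide)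
  have half: "sqrt t powr p = t powr (p / 2)" if "t \<ge> 0" for t
    using that by (simp add: powr_half_sqrt[symmetric] powr_powr)
  have m2: "(\<Sum>D\<in>Pow F. (cmod (signed_sum z F D))\<^sup>2) = ?n * S"
    unfolding S_def by (rule signed_sum_second_moment[OF F])
  have m4: "(\<Sum>D\<in>Pow F. cmod (signed_sum z F D) ^ 4) \<le> 3 * ?n * S\<^sup>2"
    unfolding S_def by (rule signed_sum_fourth_moment[OF F])
  have "(\<Sum>D\<in>Pow F. cmod (signed_sum z F D) powr p) \<le> 2 * ?n * S powr (p / 2) \<and>
      5 / 16 * ?n * S powr (p / 2) \<le> (\<Sum>D\<in>Pow F. cmod (signed_sum z F D) powr p)"
  proof (cases "S = 0")
    case True
    then have "\<forall>i\<in>F. z i = 0" using F by (simp add: S_def sum_nonneg_eq_0_iff)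
    then have "signed_sum z F D = 0" for D by (auto simp: signed_sum_def intro: sum.neutral)
    with True show ?thesis by simp
  next
    case False
    with S0 have S: "S > 0" by simp
    \<comment> \<open>After division by \<open>sqrt S\<close> the squares average to 1, so 1 + y^2
      averages to 2, the constant of the upper bound.\<close>
    have "(\<Sum>D\<in>Pow F. cmod (signed_sum z F D) powr p) \<le>
        (\<Sum>D\<in>Pow F. S powr (p / 2) * (1 + (cmod (signed_sum z F D))\<^sup>2 / S))"
    proof (rule sum_mono)
      fix D
      have "(cmod (signed_sum z F D) / sqrt S) powr p \<le> 1 + (cmod (signed_sum z F D) / sqrt S)\<^sup>2"
        using p S0 by (intro powr_le_one_plus_square) auto
      then show "cmod (signed_sum z F D) powr p \<le> S powr (p / 2) * (1 + (cmod (signed_sum z F D))\<^sup>2 / S)"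
        using S by (subst scaled[of "sqrt S"]) (auto simp: half power_divide intro!: mult_left_mono)
    qed
    also have "\<dots> = S powr (p / 2) * (?n + (\<Sum>D\<in>Pow F. (cmod (signed_sum z F D))\<^sup>2) / S)"
      unfolding sum_distrib_left[symmetric] sum.distrib sum_divide_distrib[symmetric]
      using F by (simp add: card_Pow)
    also have "\<dots> = 2 * ?n * S powr (p / 2)" using S by (simp add: m2)
    finally have upper: "(\<Sum>D\<in>Pow F. cmod (signed_sum z F D) powr p) \<le> 2 * ?n * S powr (p / 2)" .
    \<comment> \<open>Division by \<open>sqrt (2 * S)\<close> makes y^2 average to 1/2 and y^4/4 to
      at most 3/16, which leaves 5/16; division by \<open>sqrt S\<close> would leave 1/4.\<close>
    have "5 / 16 * ?n * S powr (p / 2) \<le> 5 / 16 * ?n * (2 * S) powr (p / 2)"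
      using S p by (intro mult_left_mono powr_mono2) auto
    also have "\<dots> = (2 * S) powr (p / 2) * (?n * S / (2 * S) - (3 * ?n * S\<^sup>2) / (16 * S\<^sup>2))"
      using S by (simp add: field_simps)
    also have "\<dots> \<le> (2 * S) powr (p / 2) * ((\<Sum>D\<in>Pow F. (cmod (signed_sum z F D))\<^sup>2) / (2 * S) -
        (\<Sum>D\<in>Pow F. cmod (signed_sum z F D) ^ 4) / (16 * S\<^sup>2))"
      unfolding m2 using S by (intro mult_left_mono diff_left_mono divide_right_mono m4) auto
    also have "\<dots> = (\<Sum>D\<in>Pow F. (2 * S) powr (p / 2) *
        ((cmod (signed_sum z F D))\<^sup>2 / (2 * S) - cmod (signed_sum z F D) ^ 4 / (16 * S\<^sup>2)))"
      unfolding sum_distrib_left[symmetric] sum_subtractf sum_divide_distrib[symmetric] ..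
    also have "\<dots> \<le> (\<Sum>D\<in>Pow F. cmod (signed_sum z F D) powr p)"
    proof (rule sum_mono)
      fix D
      let ?y = "cmod (signed_sum z F D) / sqrt (2 * S)"
      have "?y\<^sup>2 - ?y ^ 4 / 4 \<le> ?y powr p"
        using p S0 by (intro square_minus_fourth_le_powr) auto
      moreover have "?y\<^sup>2 = (cmod (signed_sum z F D))\<^sup>2 / (2 * S)" using S by (simp add: power_divide)
      moreover have "?y ^ 4 = cmod (signed_sum z F D) ^ 4 / (4 * S\<^sup>2)"
      proof -
        have "sqrt (2 * S) ^ 4 = ((sqrt (2 * S))\<^sup>2)\<^sup>2" by (simp flip: power_mult)
        also have "\<dots> = 4 * S\<^sup>2" using S by (simp add: power_mult_distrib)
        finally show ?thesis by (simp add: power_divide)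
      qed
      ultimately have "(cmod (signed_sum z F D))\<^sup>2 / (2 * S) - cmod (signed_sum z F D) ^ 4 / (16 * S\<^sup>2) \<le> ?y powr p"
        by simp
      then have "sqrt (2 * S) powr p * ((cmod (signed_sum z F D))\<^sup>2 / (2 * S) - cmod (signed_sum z F D) ^ 4 / (16 * S\<^sup>2)) \<le>
          cmod (signed_sum z F D) powr p"
        using S by (subst scaled[of "sqrt (2 * S)"]) (auto intro!: mult_left_mono)
      then show "(2 * S) powr (p / 2) *
        ((cmod (signed_sum z F D))\<^sup>2 / (2 * S) - cmod (signed_sum z F D) ^ 4 / (16 * S\<^sup>2)) \<le>
          cmod (signed_sum z F D) powr p"
        using S half[of "2 * S"] by simp
    qed
    finally show ?thesis using upper by blast
  qed
  then show "(\<Sum>D\<in>Pow F. cmod (signed_sum z F D) powr p) \<le>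
      2 * 2 ^ card F * (\<Sum>i\<in>F. (cmod (z i))\<^sup>2) powr (p / 2)"
    "5 / 16 * 2 ^ card F * (\<Sum>i\<in>F. (cmod (z i))\<^sup>2) powr (p / 2) \<le>
      (\<Sum>D\<in>Pow F. cmod (signed_sum z F D) powr p)" unfolding S_def by auto
qed

section \<open>From unconditionality to the square function\<close>

lemma Lp_integral_mono_norm:
  assumes p: "0 < p" and f: "memLp p f" and h: "memLp p h" and M: "0 \<le> M"
    and le: "Lp_norm p f \<le> M * Lp_norm p h"
  shows "Lp_integral p f \<le> ennreal (M powr p) * Lp_integral p h"
proof -
  have "Lp_norm p f powr p \<le> (M * Lp_norm p h) powr p"
    using p le by (intro powr_mono2) (auto simp: Lp_norm_nonneg)
  then show ?thesis
    using p f h by (simp add: Lp_integral_eq powr_mult flip: ennreal_mult)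
qed

text \<open>A signed combination is the part over \<open>F - D\<close> minus the part over
  \<open>F \<inter> D\<close>; each costs the suppression constant \<open>K\<close>, whence
  \<open>2 * K\<close>. Changing the same signs twice restores the combination, which gives the
  reverse inequality.\<close>

lemma signed_sums_equivalent:
  assumes p: "1 \<le> p" and x: "uncond_basic_seq_Lp p x I"
  shows "\<exists>M\<ge>0. \<forall>F D a. finite F \<and> F \<subseteq> I \<longrightarrow>
    Lp_norm p (\<lambda>y. signed_sum (\<lambda>i. a i * x i y) F D) \<le> M * Lp_norm p (lin_comb x F a) \<and>
    Lp_norm p (lin_comb x F a) \<le> M * Lp_norm p (\<lambda>y. signed_sum (\<lambda>i. a i * x i y) F D)"
proof -
  interpret unique_unconditional_expansions "\<lambda>c f y. c * f y" "closed_span_Lp p x I" "Lp_norm p" x I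
    by (rule unique_unconditional_expansions_Lp[OF p x])
  from suppression_constant obtain K where K0: "K \<ge> 0"
    and K_all: "\<forall>F D a. finite F \<and> F \<subseteq> I \<and> D \<subseteq> F \<longrightarrow>
      Lp_norm p (\<Sum>i\<in>D. (\<lambda>y. a i * x i y)) \<le> K * Lp_norm p (\<Sum>i\<in>F. (\<lambda>y. a i * x i y))"
    by (elim exE conjE)
  have K: "Lp_norm p (\<Sum>i\<in>D. (\<lambda>y. a i * x i y)) \<le> K * Lp_norm p (\<Sum>i\<in>F. (\<lambda>y. a i * x i y))"
    if "finite F" "F \<subseteq> I" "D \<subseteq> F" for F D a
    using K_all that by simp
  define \<epsilon> where "\<epsilon> D i = (if i \<in> D then - 1 else 1 :: complex)" for D :: "'a set" and i
  have signed: "(\<lambda>y. signed_sum (\<lambda>i. a i * x i y) F D) = lin_comb x F (\<lambda>i. \<epsilon> D i * a i)" for F D a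
    unfolding lin_comb_def signed_sum_def \<epsilon>_def by (intro ext sum.cong) auto
  have *: "Lp_norm p (lin_comb x F (\<lambda>i. \<epsilon> D i * a i)) \<le> 2 * K * Lp_norm p (lin_comb x F a)"
    if F: "finite F" "F \<subseteq> I" for F D a
  proof -
    have "lin_comb x F (\<lambda>i. \<epsilon> D i * a i) = lin_comb x (F - D) a - lin_comb x (F \<inter> D) a"
    proof
      fix y
      have "lin_comb x F (\<lambda>i. \<epsilon> D i * a i) y =
          (\<Sum>i\<in>F - D. \<epsilon> D i * a i * x i y) + (\<Sum>i\<in>F \<inter> D. \<epsilon> D i * a i * x i y)"
        unfolding lin_comb_def using F
        by (subst sum.union_disjoint[symmetric]) (auto intro!: sum.cong)
      also have "\<dots> = (\<Sum>i\<in>F - D. a i * x i y) + (\<Sum>i\<in>F \<inter> D. - (a i * x i y))"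
        by (intro arg_cong2[where f = plus] sum.cong) (auto simp: \<epsilon>_def)
      finally show "lin_comb x F (\<lambda>i. \<epsilon> D i * a i) y = (lin_comb x (F - D) a - lin_comb x (F \<inter> D) a) y"
        by (simp add: lin_comb_def sum_negf)
    qed
    moreover have mem: "lin_comb x G a \<in> closed_span_Lp p x I" if "G \<subseteq> I" for G
      unfolding lin_comb_eq_sum by (rule sum_in_V[OF that])
    have "Lp_norm p (lin_comb x (F - D) a - lin_comb x (F \<inter> D) a) \<le>
        Lp_norm p (lin_comb x (F - D) a) + Lp_norm p (lin_comb x (F \<inter> D) a)"
      using F by (intro N_diff_le mem) auto
    moreover have "Lp_norm p (lin_comb x (F - D) a) \<le> K * Lp_norm p (lin_comb x F a)"
      "Lp_norm p (lin_comb x (F \<inter> D) a) \<le> K * Lp_norm p (lin_comb x F a)"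
      unfolding lin_comb_eq_sum by (intro K F; blast)+
    ultimately show ?thesis by simp
  qed
  have "Lp_norm p (\<lambda>y. signed_sum (\<lambda>i. a i * x i y) F D) \<le> 2 * K * Lp_norm p (lin_comb x F a) \<and>
      Lp_norm p (lin_comb x F a) \<le> 2 * K * Lp_norm p (\<lambda>y. signed_sum (\<lambda>i. a i * x i y) F D)"
    if F: "finite F" "F \<subseteq> I" for F D a
  proof -
    have "(\<lambda>i. \<epsilon> D i * (\<epsilon> D i * a i)) = a" by (auto simp: \<epsilon>_def)
    with *[OF F, of D a] *[OF F, of D "\<lambda>i. \<epsilon> D i * a i"] show ?thesis unfolding signed by simp
  qed
  with K0 show ?thesis by (intro exI[of _ "2 * K"]) simp
qed

text \<open>All signed sums have comparable integrals, so their average over \<open>Pow F\<close> is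
  comparable with each of them, and Khinchine's inequality evaluates it pointwise. The comparison is
  kept in \<open>ennreal\<close> because the finiteness of the square function integral is part of
  the result.\<close>

lemma square_function_equivalence:
  assumes p: "1 \<le> p" "p \<le> 2" and x: "uncond_basic_seq_Lp p x I"
  shows "\<exists>C>0. \<forall>F a. finite F \<and> F \<subseteq> I \<longrightarrow>
    (let J = \<integral>\<^sup>+ y. ennreal ((\<Sum>i\<in>F. (cmod (a i * x i y))\<^sup>2) powr (p / 2)) \<partial>lborel
     in Lp_integral p (lin_comb x F a) \<le> ennreal C * J \<and> J \<le> ennreal C * Lp_integral p (lin_comb x F a))"
proof -
  have mem: "memLp p (x i)" if "i \<in> I" for i
    using x that by (simp add: uncond_basic_seq_Lp_def)
  from signed_sums_equivalent[OF p(1) x] obtain M where M: "M \<ge> 0" and signs: "\<forall>F D a. finite F \<and> F \<subseteq> I \<longrightarrow>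
      Lp_norm p (\<lambda>y. signed_sum (\<lambda>i. a i * x i y) F D) \<le> M * Lp_norm p (lin_comb x F a) \<and>
      Lp_norm p (lin_comb x F a) \<le> M * Lp_norm p (\<lambda>y. signed_sum (\<lambda>i. a i * x i y) F D)"
    by (elim exE conjE)
  \<comment> \<open>The two directions call for the factors 2 and 16/5 in front of
    \<open>M powr p\<close>; 4 dominates both, and the 1 keeps \<open>C\<close> positive when
    \<open>M\<close> is 0.\<close>
  define C where "C = 4 * M powr p + 1"
  have C: "C > 0" "2 * M powr p \<le> C" "16 / 5 * M powr p \<le> C"
    using powr_ge_zero[of M p] unfolding C_def by linarith+
  have "Lp_integral p (lin_comb x F a) \<le> ennreal C * J \<and> J \<le> ennreal C * Lp_integral p (lin_comb x F a)"
    if F: "finite F" "F \<subseteq> I"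
      and J_def: "J = (\<integral>\<^sup>+ y. ennreal ((\<Sum>i\<in>F. (cmod (a i * x i y))\<^sup>2) powr (p / 2)) \<partial>lborel)" for F a J
  proof -
    define L where "L = Lp_integral p (lin_comb x F a)"
    define f where "f D = (\<lambda>y. signed_sum (\<lambda>i. a i * x i y) F D)" for D
    let ?n = "2 ^ card F :: real"
    have [measurable]: "x i \<in> borel_measurable borel" if "i \<in> F" for i
      using mem[of i] that F memLp_measurable[of p "x i"] by auto
    have f_eq: "f D = (\<lambda>y. \<Sum>i\<in>F. (if i \<in> D then - a i else a i) * x i y)" for D
      unfolding f_def signed_sum_def by (intro ext sum.cong) auto
    have f: "memLp p (f D)" for D
      unfolding f_eq using p F by (intro minkowski_sum memLp_scale mem) auto
    have lc: "memLp p (lin_comb x F a)"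
      unfolding lin_comb_def using p F by (intro minkowski_sum memLp_scale mem) auto
    have fL: "Lp_integral p (f D) \<le> ennreal (M powr p) * L" "L \<le> ennreal (M powr p) * Lp_integral p (f D)" for D
      using signs[rule_format, of F a D] F p M f[of D] lc unfolding L_def f_def[symmetric]
      by (auto intro: Lp_integral_mono_norm)
    have sum_f: "(\<Sum>D\<in>Pow F. Lp_integral p (f D)) =
        (\<integral>\<^sup>+ y. ennreal (\<Sum>D\<in>Pow F. cmod (f D y) powr p) \<partial>lborel)"
      unfolding Lp_integral_def using memLp_measurable[OF f]
      by (subst nn_integral_sum[symmetric]) (auto simp: sum_ennreal)
    have J_scale: "ennreal c * J =
        (\<integral>\<^sup>+ y. ennreal (c * (\<Sum>i\<in>F. (cmod (a i * x i y))\<^sup>2) powr (p / 2)) \<partial>lborel)" if "c \<ge> 0" for c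
      unfolding J_def using that by (subst nn_integral_cmult[symmetric]) (auto simp: ennreal_mult)
    have up: "(\<Sum>D\<in>Pow F. Lp_integral p (f D)) \<le> ennreal (2 * ?n) * J"
      unfolding sum_f using p F
      by (subst J_scale) (auto simp: f_def intro!: nn_integral_mono ennreal_leI khinchine_upper)
    have low: "ennreal (5 / 16 * ?n) * J \<le> (\<Sum>D\<in>Pow F. Lp_integral p (f D))"
      unfolding sum_f using p F
      by (subst J_scale) (auto simp only: f_def intro!: nn_integral_mono ennreal_leI khinchine_lower, auto)
    have L_fin: "L < \<infinity>" using lc by (simp add: L_def memLp_def)
    then obtain l where l: "L = ennreal l" "l \<ge> 0" by (cases L) auto
    have n: "of_nat (card (Pow F)) = ennreal ?n" using F by (simp add: card_Pow ennreal_power[symmetric])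
    have "ennreal (5 / 16 * ?n) * J \<le> (\<Sum>D\<in>Pow F. ennreal (M powr p) * L)"
      by (rule order_trans[OF low]) (intro sum_mono fL)
    \<comment> \<open>This also forces \<open>J\<close> to be finite. From here on the inequalities
      live in the reals, where \<open>2 ^ card F\<close> cancels, so \<open>C\<close> does not
      depend on \<open>F\<close>.\<close>
    then have J1: "ennreal (5 / 16 * ?n) * J \<le> ennreal (?n * (M powr p * l))"
      using l M by (simp add: n ennreal_mult)
    then have "J < \<infinity>"
      by (cases J) (auto simp: ennreal_mult_top top_unique)
    then obtain j where j: "J = ennreal j" "j \<ge> 0" by (cases J) auto
    from J1 have "5 / 16 * ?n * j \<le> ?n * (M powr p * l)"
      using j l M by (simp add: ennreal_mult[symmetric])
    then have jl: "j \<le> 16 / 5 * M powr p * l" by (simp add: field_simps)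
    have "(\<Sum>D\<in>Pow F. L) \<le> (\<Sum>D\<in>Pow F. ennreal (M powr p) * Lp_integral p (f D))"
      by (intro sum_mono fL)
    also have "\<dots> = ennreal (M powr p) * (\<Sum>D\<in>Pow F. Lp_integral p (f D))"
      by (simp add: sum_distrib_left)
    also have "\<dots> \<le> ennreal (M powr p) * (ennreal (2 * ?n) * J)"
      by (intro mult_left_mono up) simp
    finally have "?n * l \<le> M powr p * (2 * ?n * j)"
      using j l by (simp add: n ennreal_mult[symmetric])
    then have lj: "l \<le> 2 * M powr p * j" by (simp add: field_simps)
    have "l \<le> C * j" using lj mult_right_mono[OF C(2) j(2)] by linarith
    moreover have "j \<le> C * l" using jl mult_right_mono[OF C(3) l(2)] by linarith
    ultimately show ?thesis
      unfolding L_def[symmetric] using j l C(1) by (simp add: ennreal_mult[symmetric])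
  qed
  with C(1) show ?thesis unfolding Let_def by (intro exI[of _ C]) simp
qed

section \<open>Separated translates\<close>

text \<open>After division by \<open>x + y\<close> both parts lie in the unit interval and add up to
  1, and there \<open>t \<le> t powr \<alpha>\<close>.\<close>

lemma powr_add_subadditive:
  fixes x y \<alpha> :: real
  assumes "0 \<le> x" "0 \<le> y" "0 < \<alpha>" "\<alpha> \<le> 1"
  shows "(x + y) powr \<alpha> \<le> x powr \<alpha> + y powr \<alpha>"
proof (cases "x + y = 0")
  case True
  with assms show ?thesis by simp
next
  case False
  with assms have pos: "x + y > 0" by simp
  have le: "t / (x + y) \<le> (t / (x + y)) powr \<alpha>" if "0 \<le> t" "t \<le> x + y" for t
    using powr_mono'[of \<alpha> 1 "t / (x + y)"] that assms pos by simp
  have "(x + y) powr \<alpha> = (x + y) powr \<alpha> * (x / (x + y) + y / (x + y))"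
    using pos by (simp flip: add_divide_distrib)
  also have "\<dots> \<le> (x + y) powr \<alpha> * ((x / (x + y)) powr \<alpha> + (y / (x + y)) powr \<alpha>)"
    using assms by (intro mult_left_mono add_mono le) auto
  also have "\<dots> = x powr \<alpha> + y powr \<alpha>"
    using pos assms by (simp add: powr_divide distrib_left)
  finally show ?thesis .
qed

lemma powr_sum_subadditive:
  fixes \<alpha> :: real
  assumes "0 < \<alpha>" "\<alpha> \<le> 1" "\<And>i. i \<in> F \<Longrightarrow> 0 \<le> f i"
  shows "(\<Sum>i\<in>F. f i) powr \<alpha> \<le> (\<Sum>i\<in>F. f i powr \<alpha>)"
  using assms(3)
proof (induction F rule: infinite_finite_induct)
  case (insert i F)
  then have "(f i + sum f F) powr \<alpha> \<le> f i powr \<alpha> + sum f F powr \<alpha>"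
    using assms by (intro powr_add_subadditive sum_nonneg) auto
  with insert show ?case by force
qed auto

lemma nn_integral_lborel_translate:
  fixes t :: real
  assumes "f \<in> borel_measurable borel"
  shows "(\<integral>\<^sup>+ y. f (y - t) \<partial>lborel) = (\<integral>\<^sup>+ y. f y \<partial>lborel)"
  using nn_integral_real_affine[OF assms, of 1 "- t"] by simp

lemma weighted_square_powr:
  fixes A u p :: real
  assumes "0 \<le> A" "0 \<le> u"
  shows "(A * u\<^sup>2) powr (p / 2) = A powr (p / 2) * u powr p"
proof -
  have "(u\<^sup>2) powr (p / 2) = u powr p"
    using assms by (cases "u = 0") (simp_all add: powr_powr flip: powr_numeral)
  then show ?thesis by (simp add: powr_mult)
qed

lemma translates_upper:
  assumes p: "1 \<le> p" "p \<le> 2" and g: "memLp p g" and A: "\<And>t. t \<in> T0 \<Longrightarrow> 0 \<le> A t"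
  shows "(\<integral>\<^sup>+ y. ennreal ((\<Sum>t\<in>T0. A t * (cmod (g (y - t)))\<^sup>2) powr (p / 2)) \<partial>lborel) \<le>
    ennreal (\<Sum>t\<in>T0. A t powr (p / 2)) * Lp_integral p g"
proof -
  have [measurable]: "g \<in> borel_measurable borel" using memLp_measurable[OF g] by simp
  have "(\<integral>\<^sup>+ y. ennreal ((\<Sum>t\<in>T0. A t * (cmod (g (y - t)))\<^sup>2) powr (p / 2)) \<partial>lborel) \<le>
      (\<integral>\<^sup>+ y. (\<Sum>t\<in>T0. ennreal (A t powr (p / 2)) * ennreal (cmod (g (y - t)) powr p)) \<partial>lborel)"
  proof (rule nn_integral_mono)
    fix y
    have "(\<Sum>t\<in>T0. A t * (cmod (g (y - t)))\<^sup>2) powr (p / 2) \<le>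
        (\<Sum>t\<in>T0. (A t * (cmod (g (y - t)))\<^sup>2) powr (p / 2))"
      using p A by (intro powr_sum_subadditive) auto
    also have "\<dots> = (\<Sum>t\<in>T0. A t powr (p / 2) * cmod (g (y - t)) powr p)"
      using A by (intro sum.cong) (auto simp: weighted_square_powr)
    finally show "ennreal ((\<Sum>t\<in>T0. A t * (cmod (g (y - t)))\<^sup>2) powr (p / 2)) \<le>
        (\<Sum>t\<in>T0. ennreal (A t powr (p / 2)) * ennreal (cmod (g (y - t)) powr p))"
      by (simp add: ennreal_leI flip: ennreal_mult)
  qed
  also have "\<dots> = (\<Sum>t\<in>T0. ennreal (A t powr (p / 2)) * (\<integral>\<^sup>+ y. ennreal (cmod (g (y - t)) powr p) \<partial>lborel))"
    by (simp add: nn_integral_sum nn_integral_cmult)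
  also have "\<dots> = (\<Sum>t\<in>T0. ennreal (A t powr (p / 2)) * Lp_integral p g)"
    unfolding Lp_integral_def
    by (subst nn_integral_lborel_translate[where f = "\<lambda>y. ennreal (cmod (g y) powr p)"]) auto
  also have "\<dots> = ennreal (\<Sum>t\<in>T0. A t powr (p / 2)) * Lp_integral p g"
    by (simp add: sum_distrib_right flip: sum_ennreal)
  finally show ?thesis .
qed

text \<open>The cells are countably many and cover the line; if none carried mass, \<open>g\<close>
  would vanish almost everywhere.\<close>

lemma exists_interval_mass_pos:
  assumes g: "memLp p g" "Lp_integral p g \<noteq> 0" and \<delta>: "0 < \<delta>"
  shows "\<exists>k::int. (\<integral>\<^sup>+ y. ennreal (cmod (g y) powr p) * indicator {of_int k * \<delta>..<(of_int k + 1) * \<delta>} y \<partial>lborel) \<noteq> 0"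
proof (rule ccontr)
  have [measurable]: "g \<in> borel_measurable borel" using memLp_measurable[OF g(1)] by simp
  assume "\<not> ?thesis"
  then have "AE y in lborel. ennreal (cmod (g y) powr p) * indicator {of_int k * \<delta>..<(of_int k + 1) * \<delta>} y = 0" for k :: int
    by (subst (asm) nn_integral_0_iff_AE) auto
  then have "AE y in lborel. \<forall>k::int. ennreal (cmod (g y) powr p) * indicator {of_int k * \<delta>..<(of_int k + 1) * \<delta>} y = 0"
    unfolding AE_all_countable by blast
  then have "AE y in lborel. ennreal (cmod (g y) powr p) = 0"
  proof eventually_elim
    case (elim y)
    have "of_int \<lfloor>y / \<delta>\<rfloor> \<le> y / \<delta>" "y / \<delta> < of_int \<lfloor>y / \<delta>\<rfloor> + 1" by linarith+
    then have "y \<in> {of_int \<lfloor>y / \<delta>\<rfloor> * \<delta>..<(of_int \<lfloor>y / \<delta>\<rfloor> + 1) * \<delta>}"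
      unfolding pos_le_divide_eq[OF \<delta>] pos_divide_less_eq[OF \<delta>] by simp
    with elim[rule_format, of "\<lfloor>y / \<delta>\<rfloor>"] show ?case by simp
  qed
  then have "Lp_integral p g = 0"
    unfolding Lp_integral_def by (subst nn_integral_0_iff_AE) auto
  with g(2) show False by simp
qed

lemma translates_lower:
  assumes p: "1 \<le> p" and g: "memLp p g" "Lp_integral p g \<noteq> 0" and T: "uniformly_discrete T"
  shows "\<exists>c>0. \<forall>T0 A. finite T0 \<and> T0 \<subseteq> T \<and> (\<forall>t\<in>T0. 0 \<le> A t) \<longrightarrow>
    ennreal (c * (\<Sum>t\<in>T0. A t powr (p / 2))) \<le>
    (\<integral>\<^sup>+ y. ennreal ((\<Sum>t\<in>T0. A t * (cmod (g (y - t)))\<^sup>2) powr (p / 2)) \<partial>lborel)"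
proof -
  have [measurable]: "g \<in> borel_measurable borel" using memLp_measurable[OF g(1)] by simp
  obtain \<delta> where \<delta>: "\<delta> > 0" "\<And>t t'. t \<in> T \<Longrightarrow> t' \<in> T \<Longrightarrow> t \<noteq> t' \<Longrightarrow> \<delta> \<le> \<bar>t - t'\<bar>"
    using T unfolding uniformly_discrete_def by blast
  from exists_interval_mass_pos[OF g \<delta>(1)] obtain k :: int where
    k: "(\<integral>\<^sup>+ y. ennreal (cmod (g y) powr p) * indicator {of_int k * \<delta>..<(of_int k + 1) * \<delta>} y \<partial>lborel) \<noteq> 0" ..
  define Q where "Q = {of_int k * \<delta>..<(of_int k + 1) * \<delta>}"
  \<comment> \<open>This mass becomes the constant. It is fixed before \<open>T0\<close> and
    \<open>A\<close> are given.\<close>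
  define m where "m = (\<integral>\<^sup>+ y. ennreal (cmod (g y) powr p) * indicator Q y \<partial>lborel)"
  have [measurable]: "Q \<in> sets borel" by (simp add: Q_def)
  \<comment> \<open>Two points of a half-open interval of length \<delta> differ by less than
    \<delta>, so \<open>y\<close> lies in at most one translate of \<open>Q\<close>.\<close>
  have Q: "t = t'" if "t \<in> T" "t' \<in> T" "y - t \<in> Q" "y - t' \<in> Q" for t t' y
  proof (rule ccontr)
    assume "t \<noteq> t'"
    with \<delta>(2)[OF that(1,2)] that(3,4) show False by (auto simp: Q_def distrib_right)
  qed
  have "m \<le> Lp_integral p g"
    unfolding m_def Lp_integral_def by (intro nn_integral_mono) (auto split: split_indicator)
  then have "m < \<infinity>" using g(1) by (auto simp: memLp_def intro: le_less_trans)
  then obtain c where c: "m = ennreal c" "c \<ge> 0" by (cases m) auto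
  with k have "c > 0" unfolding m_def[symmetric] Q_def[symmetric] by (cases "c = 0") (auto simp: m_def[symmetric])
  have "ennreal (c * (\<Sum>t\<in>T0. A t powr (p / 2))) \<le>
    (\<integral>\<^sup>+ y. ennreal ((\<Sum>t\<in>T0. A t * (cmod (g (y - t)))\<^sup>2) powr (p / 2)) \<partial>lborel)"
    if T0: "finite T0" "T0 \<subseteq> T" and A: "\<And>t. t \<in> T0 \<Longrightarrow> 0 \<le> A t" for T0 A
  proof -
    have "ennreal (c * (\<Sum>t\<in>T0. A t powr (p / 2))) = (\<Sum>t\<in>T0. ennreal (A t powr (p / 2)) * m)"
      using c by (simp add: sum_distrib_left mult.commute flip: ennreal_mult sum_ennreal)
    also have "\<dots> = (\<Sum>t\<in>T0. ennreal (A t powr (p / 2)) *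
        (\<integral>\<^sup>+ y. ennreal (cmod (g (y - t)) powr p) * indicator Q (y - t) \<partial>lborel))"
      unfolding m_def
      by (subst nn_integral_lborel_translate[where f = "\<lambda>y. ennreal (cmod (g y) powr p) * indicator Q y"]) auto
    also have "\<dots> = (\<integral>\<^sup>+ y. (\<Sum>t\<in>T0. ennreal (A t powr (p / 2)) *
        (ennreal (cmod (g (y - t)) powr p) * indicator Q (y - t))) \<partial>lborel)"
      by (simp add: nn_integral_sum nn_integral_cmult)
    also have "\<dots> \<le> (\<integral>\<^sup>+ y. ennreal ((\<Sum>t\<in>T0. A t * (cmod (g (y - t)))\<^sup>2) powr (p / 2)) \<partial>lborel)"
    proof (rule nn_integral_mono)
      fix y
      let ?h = "\<lambda>t. ennreal (A t powr (p / 2)) * (ennreal (cmod (g (y - t)) powr p) * indicator Q (y - t))"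
      show "(\<Sum>t\<in>T0. ?h t) \<le> ennreal ((\<Sum>t\<in>T0. A t * (cmod (g (y - t)))\<^sup>2) powr (p / 2))"
      proof (cases "\<exists>t\<in>T0. y - t \<in> Q")
        case False
        then have "(\<Sum>t\<in>T0. ?h t) = 0" by (intro sum.neutral) auto
        then show ?thesis by simp
      next
        case True
        then obtain t where t: "t \<in> T0" "y - t \<in> Q" by blast
        have "y - s \<notin> Q" if "s \<in> T0 - {t}" for s
          using Q[of s t y] t that T0(2) by blast
        then have "(\<Sum>s\<in>T0. ?h s) = (\<Sum>s\<in>{t}. ?h s)"
          using t T0(1) by (intro sum.mono_neutral_right) auto
        also have "\<dots> = ennreal ((A t * (cmod (g (y - t)))\<^sup>2) powr (p / 2))"
          using t A by (simp add: weighted_square_powr ennreal_mult)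
        also have "\<dots> \<le> ennreal ((\<Sum>t\<in>T0. A t * (cmod (g (y - t)))\<^sup>2) powr (p / 2))"
          using t T0 A p by (intro ennreal_leI powr_mono2 member_le_sum) auto
        finally show ?thesis .
      qed
    qed
    finally show ?thesis .
  qed
  with \<open>c > 0\<close> show ?thesis by (intro exI[of _ c]) simp
qed

section \<open>Gabor systems and the final estimate\<close>

lemma cmod_gabor: "cmod (gabor g (t, s) y) = cmod (g (y - t))"
  by (simp add: gabor_def expo_def transl_def norm_mult)

lemma Lp_integral_gabor:
  assumes "memLp p g" shows "Lp_integral p (gabor g l) = Lp_integral p g"
proof -
  have [measurable]: "g \<in> borel_measurable borel" using memLp_measurable[OF assms] by simp
  show ?thesis
    unfolding Lp_integral_def
    by (cases l) (simp add: cmod_gabor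
        nn_integral_lborel_translate[where f = "\<lambda>y. ennreal (cmod (g y) powr p)"])
qed

text \<open>Applied to a single Gabor vector, whose integral equals that of \<open>g\<close>, this
  supplies the nonvanishing of \<open>g\<close> that \<open>translates_lower\<close> asks
  for.\<close>

lemma Lp_integral_basic_nonzero:
  assumes p: "1 \<le> p" and x: "uncond_basic_seq_Lp p x I" and i: "i \<in> I"
  shows "Lp_integral p (x i) \<noteq> 0"
proof -
  interpret unique_unconditional_expansions "\<lambda>c f y. c * f y" "closed_span_Lp p x I" "Lp_norm p" x I
    by (rule unique_unconditional_expansions_Lp[OF p x])
  from N_x_pos[OF i] p show ?thesis by (auto simp: Lp_norm_def)
qed

text \<open>The support has finitely many points over \<open>t\<close>, and their second coordinates
  all lie in \<open>S t\<close>. The right-hand side is written as a fibre of \<open>fst\<close> to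
  match the grouping by \<open>sum.image_gen\<close>.\<close>

lemma infsum_fibre:
  assumes F: "finite {l. a l \<noteq> 0}" "{l. a l \<noteq> (0::complex)} \<subseteq> Sigma T S" and t: "t \<in> T"
  shows "(\<Sum>\<^sub>\<infinity>s\<in>S t. (cmod (a (t, s)))\<^sup>2) = (\<Sum>l\<in>{l \<in> {l. a l \<noteq> 0}. fst l = t}. (cmod (a l))\<^sup>2)"
proof -
  let ?G = "{s. a (t, s) \<noteq> 0}"
  have fin: "finite ?G"
    by (rule finite_subset[OF _ finite_imageI[OF F(1), of snd]]) (auto simp: image_iff)
  have "(\<Sum>\<^sub>\<infinity>s\<in>S t. (cmod (a (t, s)))\<^sup>2) = (\<Sum>\<^sub>\<infinity>s\<in>?G. (cmod (a (t, s)))\<^sup>2)"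
    using F(2) by (intro infsum_cong_neutral) auto
  also have "\<dots> = (\<Sum>s\<in>?G. (cmod (a (t, s)))\<^sup>2)" using fin by simp
  also have "\<dots> = (\<Sum>l\<in>Pair t ` ?G. (cmod (a l))\<^sup>2)"
    by (simp add: sum.reindex inj_on_def)
  also have "Pair t ` ?G = {l \<in> {l. a l \<noteq> 0}. fst l = t}" by (auto simp: image_iff)
  finally show ?thesis .
qed

theorem theorem4p1:
  fixes p :: real and T :: "real set" and S :: "real \<Rightarrow> real set" and g :: "real \<Rightarrow> complex"
  assumes "1 \<le> p" "p \<le> 2"
    and "uniformly_discrete T" "countable T"
    and "\<forall>t\<in>T. countable (S t) \<and> S t \<noteq> {}"
    and "memLp p g"
    and "uncond_basic_seq_Lp p (gabor g) (Sigma T S)"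
  shows "\<exists>A>0. \<exists>B>0. \<forall>a :: real \<times> real \<Rightarrow> complex.
           finite {l. a l \<noteq> 0} \<and> {l. a l \<noteq> 0} \<subseteq> Sigma T S \<longrightarrow>
           (let lhs = Lp_norm p (lin_comb (gabor g) {l. a l \<noteq> 0} a);
                rhs = (\<Sum>\<^sub>\<infinity>t\<in>T. (\<Sum>\<^sub>\<infinity>s\<in>S t. (cmod (a (t, s)))\<^sup>2) powr (p / 2)) powr (1 / p)
            in A * rhs \<le> lhs \<and> lhs \<le> B * rhs)"
proof (cases "T = {}")
  case True
  have "Lp_norm p (lin_comb (gabor g) {l. a l \<noteq> 0} a) = 0" if "\<forall>t s. a (t, s) = 0" for a
  proof -
    have empty: "{l. a l \<noteq> 0} = {}" using that by auto
    show ?thesis unfolding empty using assms(1) by (simp add: Lp_norm_def Lp_integral_def lin_comb_def)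
  qed
  with True show ?thesis
    by (intro exI[of _ "1::real"] conjI) (simp_all add: Let_def)
next
  case False
  with assms(5) obtain l0 where "l0 \<in> Sigma T S" by blast
  with Lp_integral_basic_nonzero[OF assms(1,7)] have g: "Lp_integral p g \<noteq> 0"
    by (metis Lp_integral_gabor[OF assms(6)])
  obtain c where c: "c > 0" and lower: "\<forall>T0 A. finite T0 \<and> T0 \<subseteq> T \<and> (\<forall>t\<in>T0. 0 \<le> A t) \<longrightarrow>
      ennreal (c * (\<Sum>t\<in>T0. A t powr (p / 2))) \<le>
      (\<integral>\<^sup>+ y. ennreal ((\<Sum>t\<in>T0. A t * (cmod (g (y - t)))\<^sup>2) powr (p / 2)) \<partial>lborel)"
    using translates_lower[OF assms(1,6) g assms(3)] by (elim exE conjE)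
  obtain C where C: "C > 0" and equiv: "\<forall>F a. finite F \<and> F \<subseteq> Sigma T S \<longrightarrow>
    (let J = \<integral>\<^sup>+ y. ennreal ((\<Sum>l\<in>F. (cmod (a l * gabor g l y))\<^sup>2) powr (p / 2)) \<partial>lborel
     in Lp_integral p (lin_comb (gabor g) F a) \<le> ennreal C * J \<and>
        J \<le> ennreal C * Lp_integral p (lin_comb (gabor g) F a))"
    using square_function_equivalence[OF assms(1,2,7)] by (elim exE conjE)
  define \<gamma> where "\<gamma> = Lp_norm p g powr p"
  have \<gamma>: "\<gamma> \<ge> 0" "Lp_integral p g = ennreal \<gamma>"
    using assms(1,6) by (simp_all add: \<gamma>_def Lp_integral_eq)
  \<comment> \<open>Let \<open>R\<close> be the \<open>p\<close>-th power of the right-hand side.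
    The chain \<open>c * R \<le> J \<le> C * L\<close> gives \<open>A\<close>, and
    \<open>L \<le> C * J\<close> with \<open>J \<le> R * \<gamma>\<close> gives \<open>B\<close>;
    the 1 makes \<open>B\<close> visibly positive.\<close>
  define A B where "A = (c / C) powr (1 / p)" and "B = (C * \<gamma> + 1) powr (1 / p)"
  have pos: "C * \<gamma> + 1 > 0" using C \<gamma>(1) by (simp add: add_nonneg_pos)
  have AB: "A > 0" "B > 0"
    using c C pos by (auto simp: A_def B_def)
  have "A * rhs \<le> lhs \<and> lhs \<le> B * rhs"
    if F: "finite {l. a l \<noteq> 0}" "{l. a l \<noteq> 0} \<subseteq> Sigma T S"
      and lhs: "lhs = Lp_norm p (lin_comb (gabor g) {l. a l \<noteq> 0} a)"
      and rhs: "rhs = (\<Sum>\<^sub>\<infinity>t\<in>T. (\<Sum>\<^sub>\<infinity>s\<in>S t. (cmod (a (t, s)))\<^sup>2) powr (p / 2)) powr (1 / p)"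
    for a lhs rhs
  proof -
    define F where "F = {l. a l \<noteq> 0}"
    have fin: "finite F" "F \<subseteq> Sigma T S" using F by (simp_all add: F_def)
    define w where "w t = (\<Sum>l\<in>{l \<in> F. fst l = t}. (cmod (a l))\<^sup>2)" for t
    have w: "w t \<ge> 0" for t by (simp add: w_def sum_nonneg)
    have T0: "finite (fst ` F)" "fst ` F \<subseteq> T" using fin by auto
    define R where "R = (\<Sum>t\<in>fst ` F. w t powr (p / 2))"
    have R: "R \<ge> 0" by (simp add: R_def sum_nonneg)
    have "(\<Sum>\<^sub>\<infinity>t\<in>T. (\<Sum>\<^sub>\<infinity>s\<in>S t. (cmod (a (t, s)))\<^sup>2) powr (p / 2)) = (\<Sum>\<^sub>\<infinity>t\<in>T. w t powr (p / 2))"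
      by (intro infsum_cong) (simp add: infsum_fibre[OF F] w_def F_def)
    \<comment> \<open>Over a \<open>t\<close> without support points the fibre sum
      \<open>w t\<close> is empty, and \<open>0 powr (p / 2)\<close> is 0.\<close>
    also have "\<dots> = (\<Sum>\<^sub>\<infinity>t\<in>fst ` F. w t powr (p / 2))"
    proof (intro infsum_cong_neutral)
      fix t assume "t \<in> T - fst ` F"
      then have empty: "{l \<in> F. fst l = t} = {}" by force
      show "w t powr (p / 2) = 0" unfolding w_def empty by simp
    qed (use T0 in auto)
    also have "\<dots> = R" using T0(1) by (simp add: R_def)
    finally have rhs_R: "rhs = R powr (1 / p)" using rhs by simp
    have sq: "(\<Sum>l\<in>F. (cmod (a l * gabor g l y))\<^sup>2) = (\<Sum>t\<in>fst ` F. w t * (cmod (g (y - t)))\<^sup>2)" for y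
    proof -
      have "(\<Sum>l\<in>F. (cmod (a l * gabor g l y))\<^sup>2) =
          (\<Sum>t\<in>fst ` F. \<Sum>l\<in>{l \<in> F. fst l = t}. (cmod (a l * gabor g l y))\<^sup>2)"
        by (rule sum.image_gen[OF fin(1)])
      also have "\<dots> = (\<Sum>t\<in>fst ` F. w t * (cmod (g (y - t)))\<^sup>2)"
        unfolding w_def sum_distrib_right
        by (intro sum.cong) (auto simp: norm_mult cmod_gabor power_mult_distrib)
      finally show ?thesis .
    qed
    define L where "L = Lp_integral p (lin_comb (gabor g) F a)"
    define J where "J = (\<integral>\<^sup>+ y. ennreal ((\<Sum>t\<in>fst ` F. w t * (cmod (g (y - t)))\<^sup>2) powr (p / 2)) \<partial>lborel)"
    have LJ: "L \<le> ennreal C * J" "J \<le> ennreal C * L"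
      using equiv[rule_format, of F a] fin unfolding L_def J_def sq Let_def by simp_all
    have J_up: "J \<le> ennreal (R * \<gamma>)"
      using translates_upper[OF assms(1,2,6), of "fst ` F" w] w R \<gamma>
      by (simp add: J_def R_def ennreal_mult)
    have J_low: "ennreal (c * R) \<le> J"
      using lower[rule_format, of "fst ` F" w] T0 w by (simp add: J_def R_def)
    have mem: "memLp p (lin_comb (gabor g) F a)"
      unfolding lin_comb_def using assms(1,7) fin
      by (intro minkowski_sum memLp_scale) (auto simp: uncond_basic_seq_Lp_def)
    have lhs0: "lhs \<ge> 0" by (simp add: lhs Lp_norm_nonneg)
    have L: "L = ennreal (lhs powr p)"
      using assms(1) mem unfolding L_def lhs F_def[symmetric] by (intro Lp_integral_eq) auto
    have root: "lhs = (lhs powr p) powr (1 / p)" using lhs0 assms(1) by (simp add: powr_powr)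
    have "ennreal (c * R) \<le> ennreal (C * lhs powr p)"
      using order_trans[OF J_low LJ(2)] C by (simp add: L ennreal_mult)
    then have "c * R \<le> C * lhs powr p" using C by simp
    then have "c / C * R \<le> lhs powr p" using C by (simp add: field_simps)
    then have "(c / C * R) powr (1 / p) \<le> (lhs powr p) powr (1 / p)"
      using c C R assms(1) by (intro powr_mono2) auto
    then have low: "A * rhs \<le> lhs"
      unfolding A_def rhs_R root[symmetric] by (simp only: powr_mult)
    have "L \<le> ennreal C * ennreal (R * \<gamma>)"
      using order_trans[OF LJ(1) mult_left_mono[OF J_up]] by simp
    then have "lhs powr p \<le> C * (R * \<gamma>)"
      using C R \<gamma>(1) by (simp add: L flip: ennreal_mult)
    also have "\<dots> \<le> (C * \<gamma> + 1) * R" using R by (simp add: algebra_simps)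
    finally have "(lhs powr p) powr (1 / p) \<le> ((C * \<gamma> + 1) * R) powr (1 / p)"
      using assms(1) by (intro powr_mono2) auto
    then have "lhs \<le> B * rhs"
      unfolding B_def rhs_R root[symmetric] by (simp only: powr_mult)
    with low show ?thesis by blast
  qed
  with AB show ?thesis unfolding Let_def by blast
qed

end
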